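(* Let $[\nabla]$ be a projective structure on a surface, $U\subset N$ an open coordinate set with coordinates $(x^1,x^2)$, $\nabla\in[\nabla]$ a representative torsion-free connection with Christoffel symbols $\Gamma^k_{ij}$ and Schouten tensor $\mathrm{P}_{ij}$, and $\Lambda\neq0$ a constant. Consider on $T^*U$ (coordinates $(x^i,\xi_i)$) the metric $$g=\left(d\xi_i-\left(\Gamma_{ij}^k \xi_k-\Lambda \xi_i\xi_j- \Lambda^{-1}\mathrm{P}_{ji}\right)dx^j\right)\odot dx^i$$ and the $2$-form $\Omega= d\xi_i\wedge dx^i+\frac{1}{\Lambda}\mathrm{P}_{ij}\, dx^i\wedge dx^j$. If $K=K^i\partial/\partial x^i$ is a projective vector field on $U$, i.e. $\mathcal{L}_K\Gamma^k_{ij}=\delta_i^k\rho_j+\delta_j^k\rho_i$ for some $1$-form $\rho$, then $$\mathcal{K}:=K-\xi_j\frac{\partial K^j}{\partial x^i}\frac{\partial}{\partial \xi_i}+\frac{1}{\Lambda}\rho_i\frac{\partial}{\partial \xi_i}$$ is a Killing vector field of $g$ satisfying $\mathcal{L}_{\mathcal K}\Omega=0$. Conversely, every Killing vector field of $g$ is of the form $\mathcal{K}$ for some projective vector field $K$ on $U$.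
   Context: A projective structure is an equivalence class of torsion-free connections with the same unparametrised geodesics. Here $\mathcal{L}_K\Gamma^k_{ij}\equiv \frac{\partial^2 K^k}{\partial x^i \partial x^j}+K^m\frac{\partial}{\partial x^m} \Gamma_{ij}^k- \Gamma_{ij}^m\frac{\partial K^k}{\partial x^m}+\Gamma_{im}^k\frac{\partial K^m}{\partial x^j}+\Gamma_{jm}^k\frac{\partial K^m}{\partial x^i}$. The curvature is $[\nabla_i,\nabla_j]X^k=R_{ij}{}^k{}_lX^l$ and the (not necessarily symmetric) Schouten tensor is defined by $R_{ij}{}^k{}_l=\delta_i{}^k\mathrm{P}_{jl}-\delta_j{}^k\mathrm{P}_{il}-2\mathrm{P}_{[ij]}\delta_l{}^k$. Indices run over $1,2$ with summation convention; $\odot$ is the symmetric tensor product. *)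

theory Defs
  imports "HOL-Analysis.Analysis"
begin

text \<open>Coordinate conventions. The coordinate set U is an open subset of real^2
(index type 2, indices 0 and 1 playing the role of 1 and 2). A point of the
cotangent bundle T*U = U x R^2 is a pair (x, xi); a tangent vector to T*U at
a point is a pair (u, eta), with dx^i(u,eta) = u$i and dxi_i(u,eta) = eta$i.\<close>

definition dd :: "'a::real_normed_vector \<Rightarrow> ('a \<Rightarrow> 'b::real_normed_vector) \<Rightarrow> 'a \<Rightarrow> 'b" where
  "dd v f p = vector_derivative (\<lambda>t. f (p + t *\<^sub>R v)) (at 0)"

fun ddl :: "'a::real_normed_vector list \<Rightarrow> ('a \<Rightarrow> 'b::real_normed_vector) \<Rightarrow> 'a \<Rightarrow> 'b" where
  "ddl [] f = f"
| "ddl (v # vs) f = dd v (ddl vs f)"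

definition Cinf_on :: "'a::real_normed_vector set \<Rightarrow> ('a \<Rightarrow> 'b::real_normed_vector) \<Rightarrow> bool" where
  "Cinf_on S f \<longleftrightarrow> (\<forall>vs. \<forall>p\<in>S. ddl vs f differentiable (at p))"

definition pdx :: "2 \<Rightarrow> (real^2 \<Rightarrow> 'b::real_normed_vector) \<Rightarrow> real^2 \<Rightarrow> 'b" where
  "pdx i f x = dd (axis i 1) f x"

definition kd :: "2 \<Rightarrow> 2 \<Rightarrow> real" where
  "kd i j = (if i = j then 1 else 0)"

text \<open>Christoffel symbols: Gam k i j x = Gamma^k_{ij}(x).
Curvature [nabla_i, nabla_j] X^k = R_{ij}^k_l X^l:
curv Gam i j k l x = R_{ij}^k_l(x).\<close>
definition curv :: "(2 \<Rightarrow> 2 \<Rightarrow> 2 \<Rightarrow> real^2 \<Rightarrow> real) \<Rightarrow> 2 \<Rightarrow> 2 \<Rightarrow> 2 \<Rightarrow> 2 \<Rightarrow> real^2 \<Rightarrow> real" where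
  "curv Gam i j k l x =
     pdx i (Gam k j l) x - pdx j (Gam k i l) x
     + (\<Sum>m\<in>UNIV. Gam k i m x * Gam m j l x - Gam k j m x * Gam m i l x)"

definition is_schouten :: "(real^2) set \<Rightarrow> (2 \<Rightarrow> 2 \<Rightarrow> 2 \<Rightarrow> real^2 \<Rightarrow> real) \<Rightarrow> (2 \<Rightarrow> 2 \<Rightarrow> real^2 \<Rightarrow> real) \<Rightarrow> bool" where
  "is_schouten U Gam P \<longleftrightarrow> (\<forall>x\<in>U. \<forall>i j k l.
     curv Gam i j k l x = kd i k * P j l x - kd j k * P i l x - (P i j x - P j i x) * kd l k)"

definition lieGam :: "(real^2 \<Rightarrow> real^2) \<Rightarrow> (2 \<Rightarrow> 2 \<Rightarrow> 2 \<Rightarrow> real^2 \<Rightarrow> real) \<Rightarrow> 2 \<Rightarrow> 2 \<Rightarrow> 2 \<Rightarrow> real^2 \<Rightarrow> real" where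
  "lieGam K Gam k i j x =
     pdx i (\<lambda>y. pdx j (\<lambda>z. K z $ k) y) x
     + (\<Sum>m\<in>UNIV. K x $ m * pdx m (Gam k i j) x)
     - (\<Sum>m\<in>UNIV. Gam m i j x * pdx m (\<lambda>z. K z $ k) x)
     + (\<Sum>m\<in>UNIV. Gam k i m x * pdx j (\<lambda>z. K z $ m) x)
     + (\<Sum>m\<in>UNIV. Gam k j m x * pdx i (\<lambda>z. K z $ m) x)"

definition projective_with :: "(real^2) set \<Rightarrow> (2 \<Rightarrow> 2 \<Rightarrow> 2 \<Rightarrow> real^2 \<Rightarrow> real) \<Rightarrow> (real^2 \<Rightarrow> real^2) \<Rightarrow> (real^2 \<Rightarrow> real^2) \<Rightarrow> bool" where
  "projective_with U Gam K rho \<longleftrightarrow> Cinf_on U K \<and>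
     (\<forall>x\<in>U. \<forall>i j k. lieGam K Gam k i j x = kd i k * rho x $ j + kd j k * rho x $ i)"

definition Aterm :: "(2 \<Rightarrow> 2 \<Rightarrow> 2 \<Rightarrow> real^2 \<Rightarrow> real) \<Rightarrow> (2 \<Rightarrow> 2 \<Rightarrow> real^2 \<Rightarrow> real) \<Rightarrow> real \<Rightarrow> 2 \<Rightarrow> 2 \<Rightarrow> real^2 \<Rightarrow> real^2 \<Rightarrow> real" where
  "Aterm Gam P Lam i j x xi = (\<Sum>k\<in>UNIV. Gam k i j x * xi $ k) - Lam * xi $ i * xi $ j - P j i x / Lam"

text \<open>The metric g = (dxi_i - A_{ij} dx^j) (.) dx^i, with a (.) b = (a (x) b + b (x) a)/2.\<close>
definition gmet :: "(2 \<Rightarrow> 2 \<Rightarrow> 2 \<Rightarrow> real^2 \<Rightarrow> real) \<Rightarrow> (2 \<Rightarrow> 2 \<Rightarrow> real^2 \<Rightarrow> real) \<Rightarrow> real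
      \<Rightarrow> (real^2) \<times> (real^2) \<Rightarrow> (real^2) \<times> (real^2) \<Rightarrow> (real^2) \<times> (real^2) \<Rightarrow> real" where
  "gmet Gam P Lam p v w =
     (1/2) * (\<Sum>i\<in>UNIV.
        (snd v $ i - (\<Sum>j\<in>UNIV. Aterm Gam P Lam i j (fst p) (snd p) * fst v $ j)) * fst w $ i
      + (snd w $ i - (\<Sum>j\<in>UNIV. Aterm Gam P Lam i j (fst p) (snd p) * fst w $ j)) * fst v $ i)"

text \<open>The 2-form Omega = dxi_i /\ dx^i + Lambda^{-1} P_{ij} dx^i /\ dx^j,
with (a /\ b)(v,w) = a(v) b(w) - a(w) b(v).\<close>
definition omega :: "(2 \<Rightarrow> 2 \<Rightarrow> real^2 \<Rightarrow> real) \<Rightarrow> real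
      \<Rightarrow> (real^2) \<times> (real^2) \<Rightarrow> (real^2) \<times> (real^2) \<Rightarrow> (real^2) \<times> (real^2) \<Rightarrow> real" where
  "omega P Lam p v w =
     (\<Sum>i\<in>UNIV. snd v $ i * fst w $ i - snd w $ i * fst v $ i)
     + (1 / Lam) * (\<Sum>i\<in>UNIV. \<Sum>j\<in>UNIV. P i j (fst p) * (fst v $ i * fst w $ j - fst w $ i * fst v $ j))"

text \<open>Lie derivative of a covariant 2-tensor T along a vector field V, evaluated
on constant vector fields v, w:
(L_V T)(v,w) = V(T(v,w)) + T(D_v V, w) + T(v, D_w V).\<close>
definition lie2 :: "('a::real_normed_vector \<Rightarrow> 'a \<Rightarrow> 'a \<Rightarrow> real) \<Rightarrow> ('a \<Rightarrow> 'a) \<Rightarrow> 'a \<Rightarrow> 'a \<Rightarrow> 'a \<Rightarrow> real" where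
  "lie2 T V p v w = dd (V p) (\<lambda>q. T q v w) p + T p (dd v V p) w + T p v (dd w V p)"

definition killing :: "'a::real_normed_vector set \<Rightarrow> ('a \<Rightarrow> 'a \<Rightarrow> 'a \<Rightarrow> real) \<Rightarrow> ('a \<Rightarrow> 'a) \<Rightarrow> bool" where
  "killing S T V \<longleftrightarrow> Cinf_on S V \<and> (\<forall>p\<in>S. \<forall>v w. lie2 T V p v w = 0)"

definition lift :: "(real^2 \<Rightarrow> real^2) \<Rightarrow> (real^2 \<Rightarrow> real^2) \<Rightarrow> real \<Rightarrow> (real^2) \<times> (real^2) \<Rightarrow> (real^2) \<times> (real^2)" where
  "lift K rho Lam p =
     (K (fst p), \<chi> i. - (\<Sum>j\<in>UNIV. snd p $ j * pdx i (\<lambda>z. K z $ j) (fst p)) + rho (fst p) $ i / Lam)"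

end

theory Submission
  imports Defs
begin

text \<open>Write the metric as $d\xi_i \odot dx^i - A_{ij} dx^i \odot dx^j$. For a field
$\mathcal{K}$ of the stated form all components of $\mathcal{L}_{\mathcal K} g$ vanish
except the $dx\,dx$ ones, which are affine in $\xi$: the linear part is
$\mathcal{L}_K\Gamma^k_{ij} - \delta^k_i\rho_j - \delta^k_j\rho_i$, and the constant part is
the symmetrisation of $\mathcal{L}_K P_{ij} + \nabla_i\rho_j$ over $\Lambda$. The
antisymmetrisation of the same tensor is $\mathcal{L}_{\mathcal K}\Omega$. Tracing
$\mathcal{L}_K R_{ij}{}^k{}_l = \nabla_i \mathcal{L}_K\Gamma^k_{jl} - \nabla_j \mathcal{L}_K\Gamma^k_{il}$
shows that this tensor vanishes when $K$ is projective.

Conversely, for a Killing field $V$ the $d\xi\,d\xi$ equations make $V^i$ affine in $\xi$ with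
vertical derivative $c\,\epsilon^{ij}$, $c = c(x)$. Integrability in $\xi$ of the $d\xi\,dx$ equations gives
$\partial_1 c + c (\Gamma^1_{11} + \Gamma^2_{12} - 3\Lambda\xi_1) = 0$, so $c = 0$ since $\Lambda \neq 0$.
Hence $V^i = K^i(x)$, the $d\xi\,dx$ equations determine the $\xi$-dependence of the remaining
components, and the $\xi$-linear part of the $dx\,dx$ equations says that $K$ is projective.\<close>

subsection \<open>Directional derivatives and smooth functions\<close>

text \<open>Chain rule along the line \<open>p + t *\<^sub>R v\<close> at \<open>t = 0\<close>.
  Together with its converse below it identifies \<open>dd\<close> with the Frechet derivative
  wherever the latter exists, so that the usual differentiation rules carry over.\<close>

lemma dd_has_derivative:
  assumes "(f has_derivative D) (at p)"
  shows "dd v f p = D v"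
proof -
  have 1: "((\<lambda>t. p + t *\<^sub>R v) has_derivative (\<lambda>t. t *\<^sub>R v)) (at (0::real))"
    by (auto intro!: derivative_eq_intros)
  have 2: "(f has_derivative D) (at (p + (0::real) *\<^sub>R v))"
    using assms by simp
  have "((\<lambda>t. f (p + t *\<^sub>R v)) has_derivative (\<lambda>t. D (t *\<^sub>R v))) (at (0::real))"
    using has_derivative_compose[OF 1 2] .
  moreover have "D (t *\<^sub>R v) = t *\<^sub>R D v" for t :: real
    using assms by (simp add: has_derivative_def bounded_linear.linear linear_cmul)
  ultimately have "((\<lambda>t. f (p + t *\<^sub>R v)) has_vector_derivative D v) (at 0)"
    by (simp add: has_vector_derivative_def)
  then show ?thesis
    unfolding dd_def by (rule vector_derivative_at)
qed

lemma has_derivative_dd: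
  assumes "f differentiable (at p)"
  shows "(f has_derivative (\<lambda>v. dd v f p)) (at p)"
proof -
  obtain D where D: "(f has_derivative D) (at p)"
    using assms by (auto simp: differentiable_def)
  moreover have "(\<lambda>v. dd v f p) = D"
    using dd_has_derivative[OF D] by auto
  ultimately show ?thesis by simp
qed

lemma has_vector_derivative_dd_line:
  assumes "f differentiable (at (p + t *\<^sub>R v))"
  shows "((\<lambda>t. f (p + t *\<^sub>R v)) has_vector_derivative dd v f (p + t *\<^sub>R v)) (at t)"
proof -
  have 1: "((\<lambda>t. p + t *\<^sub>R v) has_derivative (\<lambda>t. t *\<^sub>R v)) (at t)"
    by (auto intro!: derivative_eq_intros)
  have 2: "(f has_derivative (\<lambda>u. dd u f (p + t *\<^sub>R v))) (at (p + t *\<^sub>R v))"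
    by (rule has_derivative_dd[OF assms])
  then have "dd (s *\<^sub>R v) f (p + t *\<^sub>R v) = s *\<^sub>R dd v f (p + t *\<^sub>R v)" for s
    using has_derivative_bounded_linear[OF 2] linear_cmul[OF bounded_linear.linear] by blast
  with has_derivative_compose[OF 1 2] show ?thesis
    by (simp add: has_vector_derivative_def)
qed

lemma dd_cong_open:
  assumes "open S" "p \<in> S" "\<And>q. q \<in> S \<Longrightarrow> f q = g q"
  shows "dd v f p = dd v g p"
proof -
  have "isCont (\<lambda>t::real. p + t *\<^sub>R v) 0"
    by (intro continuous_intros)
  then have "\<forall>\<^sub>F t::real in at 0. p + t *\<^sub>R v \<in> S"
    using assms(1,2) by (auto simp: isCont_def elim!: topological_tendstoD)
  \<comment> \<open>The neighbourhood includes \<open>t = 0\<close>, where equality comes from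
    \<open>p \<in> S\<close>; a derivative at 0 depends on the value there as well.\<close>
  then have "\<forall>\<^sub>F t in nhds 0. f (p + t *\<^sub>R v) = g (p + t *\<^sub>R v)"
    using assms(2,3) by (auto simp: eventually_nhds_conv_at elim!: eventually_mono)
  then show ?thesis
    unfolding dd_def by (intro vector_derivative_cong_eq) (auto simp: assms)
qed

lemma differentiable_cong_open:
  assumes "open S" "p \<in> S" "\<And>q. q \<in> S \<Longrightarrow> f q = g q"
  shows "f differentiable (at p) \<longleftrightarrow> g differentiable (at p)"
  using assms has_derivative_transform_within_open[of f _ p UNIV S g]
    has_derivative_transform_within_open[of g _ p UNIV S f]
  unfolding differentiable_def by metis

lemma dd_const [simp]: "dd v (\<lambda>q. c) p = 0"
  by (rule dd_has_derivative) auto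

lemma differentiable_bounded_linear:
  assumes "bounded_linear L" "f differentiable (at p)"
  shows "(\<lambda>q. L (f q)) differentiable (at p)"
  using bounded_linear.has_derivative[OF assms(1)] assms(2) unfolding differentiable_def by blast

lemma dd_bounded_linear:
  assumes "bounded_linear L" "f differentiable (at p)"
  shows "dd v (\<lambda>q. L (f q)) p = L (dd v f p)"
  by (rule dd_has_derivative[OF bounded_linear.has_derivative[OF assms(1) has_derivative_dd[OF assms(2)]]])

lemma dd_linear [simp]: "bounded_linear L \<Longrightarrow> dd v L p = L v"
  by (intro dd_has_derivative bounded_linear_imp_has_derivative)

lemma dd_add:
  assumes "f differentiable (at p)" "g differentiable (at p)"
  shows "dd v (\<lambda>q. f q + g q) p = dd v f p + dd v g p"
  by (rule dd_has_derivative[OF has_derivative_add[OF assms[THEN has_derivative_dd]]])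

lemma dd_diff:
  assumes "f differentiable (at p)" "g differentiable (at p)"
  shows "dd v (\<lambda>q. f q - g q) p = dd v f p - dd v g p"
  by (rule dd_has_derivative[OF has_derivative_diff[OF assms[THEN has_derivative_dd]]])

lemma dd_minus:
  assumes "f differentiable (at p)"
  shows "dd v (\<lambda>q. - f q) p = - dd v f p"
  by (rule dd_has_derivative[OF has_derivative_minus[OF assms[THEN has_derivative_dd]]])

lemma dd_mult:
  fixes f g :: "'a::real_normed_vector \<Rightarrow> real"
  assumes "f differentiable (at p)" "g differentiable (at p)"
  shows "dd v (\<lambda>q. f q * g q) p = f p * dd v g p + dd v f p * g p"
  by (rule dd_has_derivative[OF has_derivative_mult[OF assms[THEN has_derivative_dd]]])

lemma dd_divide:
  fixes f :: "'a::real_normed_vector \<Rightarrow> real"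
  assumes "f differentiable (at p)"
  shows "dd v (\<lambda>q. f q / c) p = dd v f p / c"
  by (rule dd_bounded_linear[OF bounded_linear_divide assms])

lemma dd_vec_nth:
  assumes "f differentiable (at p)"
  shows "dd v (\<lambda>q. f q $ i) p = dd v f p $ i"
  by (rule dd_bounded_linear[OF bounded_linear_vec_nth assms])

lemma dd_fst:
  assumes "f differentiable (at p)"
  shows "dd v (\<lambda>q. fst (f q)) p = fst (dd v f p)"
  by (rule dd_bounded_linear[OF bounded_linear_fst assms])

lemma dd_snd:
  assumes "f differentiable (at p)"
  shows "dd v (\<lambda>q. snd (f q)) p = snd (dd v f p)"
  by (rule dd_bounded_linear[OF bounded_linear_snd assms])

text \<open>The line through \<open>p\<close> in direction \<open>v\<close> projects to the line
  through \<open>fst p\<close> in direction \<open>fst v\<close>, so both sides are the derivative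
  of one and the same function of \<open>t\<close>.\<close>

lemma dd_compose_fst: "dd v (\<lambda>q. f (fst q)) p = dd (fst v) f (fst p)"
  by (simp add: dd_def)

lemma dd_eq_sum_pdx:
  fixes f :: "real^2 \<Rightarrow> real"
  assumes "f differentiable (at x)"
  shows "dd u f x = (\<Sum>i\<in>UNIV. u $ i * pdx i f x)"
proof -
  have lin: "linear (\<lambda>v. dd v f x)"
    using has_derivative_dd[OF assms] has_derivative_linear by blast
  have "dd u f x = dd (\<Sum>i\<in>UNIV. u $ i *\<^sub>R axis i 1) f x"
    by (simp only: basis_expansion[of u, unfolded scalar_mult_eq_scaleR])
  also have "\<dots> = (\<Sum>i\<in>UNIV. u $ i * pdx i f x)"
    using linear_sum[OF lin, of "\<lambda>i. u $ i *\<^sub>R axis i 1" UNIV] linear_cmul[OF lin]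
    by (simp add: pdx_def)
  finally show ?thesis .
qed

section \<open>Differentiability of finite order and closure properties of smooth functions\<close>

primrec Cfin_on :: "nat \<Rightarrow> 'a::real_normed_vector set \<Rightarrow> ('a \<Rightarrow> 'b::real_normed_vector) \<Rightarrow> bool" where
  "Cfin_on 0 S f \<longleftrightarrow> (\<forall>p\<in>S. f differentiable (at p))"
| "Cfin_on (Suc n) S f \<longleftrightarrow> (\<forall>p\<in>S. f differentiable (at p)) \<and> (\<forall>v. Cfin_on n S (dd v f))"

text \<open>\<open>ddl\<close> applies the head of the list last, so the appended direction is
  differentiated first. This is the order in which \<open>Cfin_on\<close> unfolds.\<close>

lemma ddl_snoc: "ddl (vs @ [v]) f = ddl vs (dd v f)"
  by (induction vs) auto

text \<open>This connects smoothness, defined through lists of directions, with a recursion on the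
  order. The recursion suits closure proofs: rules such as Leibniz's replace a function by sums of
  new ones, and an induction on the order with the functions arbitrary absorbs them.\<close>

lemma Cfin_on_iff:
  "Cfin_on n S f \<longleftrightarrow> (\<forall>vs. length vs \<le> n \<longrightarrow> (\<forall>p\<in>S. ddl vs f differentiable (at p)))"
proof (induction n arbitrary: f)
  case (Suc n)
  show ?case
  proof
    assume L: "Cfin_on (Suc n) S f"
    show "\<forall>vs. length vs \<le> Suc n \<longrightarrow> (\<forall>p\<in>S. ddl vs f differentiable (at p))"
    proof (intro allI impI)
      fix vs :: "'a list" assume "length vs \<le> Suc n"
      then show "\<forall>p\<in>S. ddl vs f differentiable (at p)"
        using L Suc.IH by (cases vs rule: rev_cases) (auto simp: ddl_snoc)
    qed
  next
    assume R: "\<forall>vs. length vs \<le> Suc n \<longrightarrow> (\<forall>p\<in>S. ddl vs f differentiable (at p))"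
    have "\<forall>p\<in>S. f differentiable (at p)"
      using R[rule_format, of "[]"] by simp
    moreover have "Cfin_on n S (dd v f)" for v
      unfolding Suc.IH
    proof (intro allI impI)
      fix vs :: "'a list" assume "length vs \<le> n"
      then show "\<forall>p\<in>S. ddl vs (dd v f) differentiable (at p)"
        using R[rule_format, of "vs @ [v]"] by (simp add: ddl_snoc)
    qed
    ultimately show "Cfin_on (Suc n) S f" by simp
  qed
qed simp

lemma Cinf_on_iff_Cfin_on: "Cinf_on S f \<longleftrightarrow> (\<forall>n. Cfin_on n S f)"
  unfolding Cinf_on_def Cfin_on_iff by blast

lemma Cinf_on_differentiable: "Cinf_on S f \<Longrightarrow> p \<in> S \<Longrightarrow> f differentiable (at p)"
  unfolding Cinf_on_def by (metis ddl.simps(1))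

lemma Cinf_on_dd: "Cinf_on S f \<Longrightarrow> Cinf_on S (dd v f)"
  unfolding Cinf_on_def by (metis ddl_snoc)

lemma Cinf_on_pdx: "Cinf_on S f \<Longrightarrow> Cinf_on S (pdx i f)"
  using Cinf_on_dd[of S f "axis i 1"] by (simp add: pdx_def[abs_def])

lemma Cfin_on_Suc_imp: "Cfin_on (Suc n) S f \<Longrightarrow> Cfin_on n S f"
  unfolding Cfin_on_iff by auto

lemma Cfin_on_cong:
  assumes "open S" "\<And>q. q \<in> S \<Longrightarrow> f q = g q"
  shows "Cfin_on n S f \<longleftrightarrow> Cfin_on n S g"
  using assms(2)
proof (induction n arbitrary: f g)
  case 0
  then show ?case using differentiable_cong_open[OF assms(1)] by (metis Cfin_on.simps(1))
next
  case (Suc n)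
  have "Cfin_on n S (dd v f) \<longleftrightarrow> Cfin_on n S (dd v g)" for v
    by (rule Suc.IH) (rule dd_cong_open[OF assms(1) _ Suc.prems])
  moreover have "(\<forall>p\<in>S. f differentiable (at p)) \<longleftrightarrow> (\<forall>p\<in>S. g differentiable (at p))"
    using differentiable_cong_open[OF assms(1)] Suc.prems by metis
  ultimately show ?case by simp
qed

lemma Cinf_on_cong:
  assumes "open S" "\<And>q. q \<in> S \<Longrightarrow> f q = g q"
  shows "Cinf_on S f \<longleftrightarrow> Cinf_on S g"
  unfolding Cinf_on_iff_Cfin_on using Cfin_on_cong[OF assms] by simp

lemma Cinf_on_const: "Cinf_on S (\<lambda>q. c)"
proof -
  have "Cfin_on n S (\<lambda>q. c)" for n
    by (induction n arbitrary: c) (auto simp: dd_const[abs_def])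
  then show ?thesis unfolding Cinf_on_iff_Cfin_on by blast
qed

lemma Cfin_on_add:
  assumes "open S"
  shows "Cfin_on n S f \<Longrightarrow> Cfin_on n S g \<Longrightarrow> Cfin_on n S (\<lambda>q. f q + g q)"
proof (induction n arbitrary: f g)
  case (Suc n)
  have "Cfin_on n S (\<lambda>q. dd v f q + dd v g q)" for v
    using Suc by simp
  moreover have "Cfin_on n S (dd v (\<lambda>q. f q + g q)) \<longleftrightarrow> Cfin_on n S (\<lambda>q. dd v f q + dd v g q)" for v
    using Suc.prems by (intro Cfin_on_cong[OF assms] dd_add) auto
  ultimately show ?case using Suc.prems by auto
qed auto

lemma Cinf_on_add:
  assumes "open S" "Cinf_on S f" "Cinf_on S g"
  shows "Cinf_on S (\<lambda>q. f q + g q)"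
  using assms Cfin_on_add unfolding Cinf_on_iff_Cfin_on by blast

text \<open>By the product rule each derivative is a sum of two products in which one factor has
  been differentiated; the other factor is lowered to the same order by
  \<open>Cfin_on_Suc_imp\<close>, and the induction hypothesis applies to both products.\<close>

lemma Cfin_on_mult:
  fixes f g :: "'a::real_normed_vector \<Rightarrow> real"
  assumes "open S"
  shows "Cfin_on n S f \<Longrightarrow> Cfin_on n S g \<Longrightarrow> Cfin_on n S (\<lambda>q. f q * g q)"
proof (induction n arbitrary: f g)
  case (Suc n)
  have "Cfin_on n S (\<lambda>q. f q * dd v g q + dd v f q * g q)" for v
    using Suc.prems
    by (intro Cfin_on_add[OF assms] Suc.IH) (auto simp del: Cfin_on.simps dest: Cfin_on_Suc_imp, auto)
  moreover have "Cfin_on n S (dd v (\<lambda>q. f q * g q)) \<longleftrightarrow> Cfin_on n S (\<lambda>q. f q * dd v g q + dd v f q * g q)" for v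
    using Suc.prems by (intro Cfin_on_cong[OF assms] dd_mult) auto
  ultimately show ?case using Suc.prems by auto
qed auto

lemma Cinf_on_mult:
  fixes f g :: "'a::real_normed_vector \<Rightarrow> real"
  assumes "open S" "Cinf_on S f" "Cinf_on S g"
  shows "Cinf_on S (\<lambda>q. f q * g q)"
  using assms Cfin_on_mult unfolding Cinf_on_iff_Cfin_on by blast

lemma Cfin_on_bounded_linear:
  assumes "open S" "bounded_linear L"
  shows "Cfin_on n S f \<Longrightarrow> Cfin_on n S (\<lambda>q. L (f q))"
proof (induction n arbitrary: f)
  case 0
  then show ?case
    by (auto intro: differentiable_bounded_linear[OF assms(2)])
next
  case (Suc n)
  have "Cfin_on n S (dd v (\<lambda>q. L (f q))) \<longleftrightarrow> Cfin_on n S (\<lambda>q. L (dd v f q))" for v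
    using Suc.prems by (intro Cfin_on_cong[OF assms(1)] dd_bounded_linear assms) auto
  moreover have "(\<lambda>q. L (f q)) differentiable (at p)" if "p \<in> S" for p
    using Suc.prems that by (intro differentiable_bounded_linear[OF assms(2)]) simp
  ultimately show ?case using Suc by simp
qed

lemma Cinf_on_bounded_linear:
  assumes "open S" "bounded_linear L" "Cinf_on S f"
  shows "Cinf_on S (\<lambda>q. L (f q))"
  using assms Cfin_on_bounded_linear unfolding Cinf_on_iff_Cfin_on by blast

text \<open>The first derivatives are the constants \<open>L v\<close>, so all higher ones
  vanish.\<close>

lemma Cinf_on_linear:
  assumes "bounded_linear L"
  shows "Cinf_on S L"
proof -
  have "dd v L = (\<lambda>q. L v)" for v
    using assms by (simp add: fun_eq_iff)
  then have "Cfin_on n S L" for n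
    using Cinf_on_const[unfolded Cinf_on_iff_Cfin_on] bounded_linear_imp_differentiable[OF assms]
    by (cases n) auto
  then show ?thesis unfolding Cinf_on_iff_Cfin_on by blast
qed

lemma Cinf_on_minus:
  assumes "open S" "Cinf_on S f"
  shows "Cinf_on S (\<lambda>q. - f q)"
  by (rule Cinf_on_bounded_linear[OF assms(1) bounded_linear_minus[OF bounded_linear_ident] assms(2)])

lemma Cinf_on_diff:
  assumes "open S" "Cinf_on S f" "Cinf_on S g"
  shows "Cinf_on S (\<lambda>q. f q - g q)"
  using Cinf_on_add[OF assms(1,2) Cinf_on_minus[OF assms(1,3)]] by simp

lemma Cinf_on_divide:
  fixes f :: "'a::real_normed_vector \<Rightarrow> real"
  assumes "open S" "Cinf_on S f"
  shows "Cinf_on S (\<lambda>q. f q / c)"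
  by (rule Cinf_on_bounded_linear[OF assms(1) bounded_linear_divide assms(2)])

lemma Cinf_on_sum:
  assumes "open S" "\<And>i. i \<in> I \<Longrightarrow> Cinf_on S (f i)"
  shows "Cinf_on S (\<lambda>q. \<Sum>i\<in>I. f i q)"
  using assms(2)
  by (induction I rule: infinite_finite_induct) (auto intro!: Cinf_on_const Cinf_on_add assms(1))

lemma Cinf_on_vec_nth:
  assumes "open S" "Cinf_on S f"
  shows "Cinf_on S (\<lambda>q. f q $ i)"
  by (rule Cinf_on_bounded_linear[OF assms(1) bounded_linear_vec_nth assms(2)])

lemma Cinf_on_vec_lambda:
  fixes f :: "'a::real_normed_vector \<Rightarrow> 'n::finite \<Rightarrow> real"
  assumes "open S" "\<And>i. Cinf_on S (\<lambda>q. f q i)"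
  shows "Cinf_on S (\<lambda>q. \<chi> i. f q i)"
proof -
  have "Cinf_on S (\<lambda>q. \<Sum>i\<in>UNIV. f q i *\<^sub>R axis i (1::real))"
    by (intro Cinf_on_sum Cinf_on_bounded_linear[OF assms(1) bounded_linear_scaleR_left] assms)
  moreover have "(\<Sum>i\<in>UNIV. f q i *\<^sub>R axis i (1::real)) = (\<chi> i. f q i)" for q
    using basis_expansion[of "\<chi> i. f q i"] by (simp add: scalar_mult_eq_scaleR)
  ultimately show ?thesis by simp
qed

lemma Cinf_on_Pair:
  assumes "open S" "Cinf_on S f" "Cinf_on S g"
  shows "Cinf_on S (\<lambda>q. (f q, g q))"
proof -
  have "Cinf_on S (\<lambda>q. (f q, 0) + (0, g q))"
    using assms by (intro Cinf_on_add
        Cinf_on_bounded_linear[OF _ bounded_linear_Pair[OF bounded_linear_ident bounded_linear_zero]]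
        Cinf_on_bounded_linear[OF _ bounded_linear_Pair[OF bounded_linear_zero bounded_linear_ident]])
  then show ?thesis by simp
qed

section \<open>Pullback to a product and restriction to the zero section\<close>

lemma ddl_compose_fst: "ddl vs (\<lambda>q. f (fst q)) = (\<lambda>q. ddl (map fst vs) f (fst q))"
  by (induction vs) (auto simp: dd_compose_fst)

lemma Cinf_on_compose_fst:
  assumes "Cinf_on U f"
  shows "Cinf_on (U \<times> T) (\<lambda>q. f (fst q))"
  unfolding Cinf_on_def ddl_compose_fst
proof (intro allI ballI)
  fix vs :: "('a \<times> 'c) list" and p :: "'a \<times> 'c" assume "p \<in> U \<times> T"
  then have "ddl (map fst vs) f differentiable (at (fst p))"
    using assms by (auto simp: Cinf_on_def)
  then show "(\<lambda>q. ddl (map fst vs) f (fst q)) differentiable (at p)"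
    unfolding differentiable_def
    using has_derivative_compose[OF has_derivative_fst[OF has_derivative_ident]] by blast
qed

lemma dd_zero_section: "dd v (\<lambda>x. f (x, 0)) x = dd (v, 0) f (x, 0)"
  by (simp add: dd_def)

lemma ddl_zero_section: "ddl vs (\<lambda>x. f (x, 0)) = (\<lambda>x. ddl (map (\<lambda>v. (v, 0)) vs) f (x, 0))"
  by (induction vs) (auto simp: dd_zero_section)

text \<open>Restriction to \<open>xi = 0\<close> commutes with differentiation once a base direction
  \<open>v\<close> is lifted to \<open>(v, 0)\<close>. This later gives smoothness of the data read
  off a Killing field along the zero section.\<close>

lemma Cinf_on_zero_section:
  assumes "Cinf_on (U \<times> T) f" "0 \<in> T"
  shows "Cinf_on U (\<lambda>x. f (x, 0))"
  unfolding Cinf_on_def ddl_zero_section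
proof (intro allI ballI)
  fix vs :: "'a list" and x :: 'a assume "x \<in> U"
  then have "ddl (map (\<lambda>v. (v, 0)) vs) f differentiable (at (x, 0))"
    using assms by (auto simp: Cinf_on_def)
  then show "(\<lambda>x. ddl (map (\<lambda>v. (v, 0)) vs) f (x, 0)) differentiable (at x)"
    unfolding differentiable_def
    using has_derivative_compose[OF has_derivative_Pair[OF has_derivative_ident has_derivative_const]] by blast
qed

section \<open>Symmetry of second derivatives\<close>

lemma dd_second_difference:
  fixes f :: "'a::real_normed_vector \<Rightarrow> real"
  assumes f: "\<And>q. q \<in> S \<Longrightarrow> f differentiable (at q)"
    and fv: "\<And>q. q \<in> S \<Longrightarrow> dd v f differentiable (at q)"
    and t: "0 < t"
    and box: "\<And>a b. 0 \<le> a \<Longrightarrow> a \<le> t \<Longrightarrow> 0 \<le> b \<Longrightarrow> b \<le> t \<Longrightarrow> p + a *\<^sub>R v + b *\<^sub>R w \<in> S"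
  shows "\<exists>a b. 0 < a \<and> a < t \<and> 0 < b \<and> b < t \<and>
    f (p + t *\<^sub>R v + t *\<^sub>R w) - f (p + t *\<^sub>R v) - f (p + t *\<^sub>R w) + f p
      = t * t * dd w (dd v f) (p + a *\<^sub>R v + b *\<^sub>R w)"
proof -
  let ?h = "\<lambda>s. f (p + t *\<^sub>R w + s *\<^sub>R v) - f (p + s *\<^sub>R v)"
  let ?h' = "\<lambda>s. dd v f (p + t *\<^sub>R w + s *\<^sub>R v) - dd v f (p + s *\<^sub>R v)"
  \<comment> \<open>The second difference is the increment of \<open>?h\<close>, the difference of
    \<open>f\<close> along two parallel lines; the mean value theorem in direction \<open>v\<close>
    turns it into a difference of values of \<open>dd v f\<close>.\<close>
  have "\<exists>z. 0 < z \<and> z < t \<and> ?h t - ?h 0 = (t - 0) * ?h' z"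
  proof (rule MVT2[OF t])
    fix s assume s: "0 \<le> s" "s \<le> t"
    have "p + t *\<^sub>R w + s *\<^sub>R v \<in> S" "p + s *\<^sub>R v \<in> S"
      using box[of s t] box[of s 0] s t by (simp_all add: algebra_simps)
    then show "(?h has_field_derivative ?h' s) (at s)"
      unfolding has_real_derivative_iff_has_vector_derivative
      by (intro has_vector_derivative_diff has_vector_derivative_dd_line f)
  qed
  then obtain a where a: "0 < a" "a < t" "?h t - ?h 0 = t * ?h' a" by auto
  let ?k = "\<lambda>s. dd v f (p + a *\<^sub>R v + s *\<^sub>R w)"
  \<comment> \<open>That difference of \<open>dd v f\<close> runs along direction \<open>w\<close>,
    so a second use of the mean value theorem gives the mixed derivative.\<close>
  have "\<exists>z. 0 < z \<and> z < t \<and> ?k t - ?k 0 = (t - 0) * dd w (dd v f) (p + a *\<^sub>R v + z *\<^sub>R w)"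
  proof (rule MVT2[OF t])
    fix s assume s: "0 \<le> s" "s \<le> t"
    have "p + a *\<^sub>R v + s *\<^sub>R w \<in> S"
      using box[of a s] s a by simp
    then show "(?k has_field_derivative dd w (dd v f) (p + a *\<^sub>R v + s *\<^sub>R w)) (at s)"
      unfolding has_real_derivative_iff_has_vector_derivative
      by (intro has_vector_derivative_dd_line fv)
  qed
  then obtain b where b: "0 < b" "b < t" "?k t - ?k 0 = t * dd w (dd v f) (p + a *\<^sub>R v + b *\<^sub>R w)" by auto
  have "f (p + t *\<^sub>R v + t *\<^sub>R w) - f (p + t *\<^sub>R v) - f (p + t *\<^sub>R w) + f p = ?h t - ?h 0"
    by (simp add: algebra_simps)
  also have "\<dots> = t * (?k t - ?k 0)"
    unfolding a(3) by (simp add: algebra_simps)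
  also have "\<dots> = t * t * dd w (dd v f) (p + a *\<^sub>R v + b *\<^sub>R w)"
    unfolding b(3) by simp
  finally show ?thesis using a b by blast
qed

text \<open>The second difference of \<open>f\<close> over a parallelogram is symmetric in its two
  sides. Hence the two mixed derivatives agree at some pair of points of every small parallelogram
  at \<open>p\<close>, and their continuity excludes different values at \<open>p\<close>.\<close>

lemma dd_commute:
  fixes f :: "'a::real_normed_vector \<Rightarrow> real"
  assumes S: "open S" "p \<in> S" and f: "Cinf_on S f"
  shows "dd v (dd w f) p = dd w (dd v f) p"
proof (rule ccontr)
  let ?F = "dd v (dd w f)" and ?G = "dd w (dd v f)"
  assume ne: "?F p \<noteq> ?G p"
  \<comment> \<open>Half the supposed gap: two errors below \<open>e\<close> cannot bridge
    it.\<close>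
  define e where "e = \<bar>?F p - ?G p\<bar> / 2"
  have e: "e > 0" using ne by (simp add: e_def)
  have near_value: "\<exists>d>0. \<forall>q. dist q p < d \<longrightarrow> dist (h q) (h p) < e" if "isCont h p" for h :: "'a \<Rightarrow> real"
    using that e unfolding continuous_at_eps_delta by blast
  have "isCont ?F p" "isCont ?G p"
    using f S(2) by (auto intro!: differentiable_imp_continuous_within Cinf_on_differentiable Cinf_on_dd)
  then obtain d1 d2 where d1: "d1 > 0" "\<And>q. dist q p < d1 \<Longrightarrow> dist (?F q) (?F p) < e"
    and d2: "d2 > 0" "\<And>q. dist q p < d2 \<Longrightarrow> dist (?G q) (?G p) < e"
    using near_value by metis
  obtain d3 where d3: "d3 > 0" "\<And>q. dist q p < d3 \<Longrightarrow> q \<in> S"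
    using S unfolding open_dist by metis
  define d where "d = min d1 (min d2 d3)"
  \<comment> \<open>With this side length the whole parallelogram lies within \<open>d\<close> of
    \<open>p\<close>; the summand 1 keeps the denominator positive when both directions
    vanish.\<close>
  define t where "t = d / (2 * (norm v + norm w + 1))"
  have d: "d > 0" using d1 d2 d3 by (simp add: d_def)
  have n: "norm v + norm w + 1 > 0" by (simp add: add_nonneg_pos)
  have t: "t > 0" using d n by (simp add: t_def)
  have near: "dist (p + a *\<^sub>R v + b *\<^sub>R w) p < d" if "0 \<le> a" "a \<le> t" "0 \<le> b" "b \<le> t" for a b
  proof -
    have "dist (p + a *\<^sub>R v + b *\<^sub>R w) p = norm (a *\<^sub>R v + b *\<^sub>R w)"
      by (simp add: dist_norm algebra_simps)
    also have "\<dots> \<le> a * norm v + b * norm w"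
      using norm_triangle_ineq[of "a *\<^sub>R v" "b *\<^sub>R w"] that by simp
    also have "\<dots> \<le> t * norm v + t * norm w"
      using that by (intro add_mono mult_right_mono) auto
    also have "\<dots> \<le> t * (norm v + norm w + 1)"
      using t by (simp add: algebra_simps)
    also have "\<dots> = d / 2"
      using n by (simp add: t_def field_simps)
    finally show ?thesis using d by simp
  qed
  have box: "p + a *\<^sub>R v + b *\<^sub>R w \<in> S" if "0 \<le> a" "a \<le> t" "0 \<le> b" "b \<le> t" for a b
    using near[OF that] d3 by (auto simp: d_def)
  obtain a b where ab: "0 < a" "a < t" "0 < b" "b < t"
    "f (p + t *\<^sub>R v + t *\<^sub>R w) - f (p + t *\<^sub>R v) - f (p + t *\<^sub>R w) + f p
      = t * t * ?G (p + a *\<^sub>R v + b *\<^sub>R w)"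
    using dd_second_difference[of S f v t p w] t box f
    by (auto intro: Cinf_on_differentiable Cinf_on_dd)
  have box': "p + a *\<^sub>R w + b *\<^sub>R v \<in> S" if "0 \<le> a" "a \<le> t" "0 \<le> b" "b \<le> t" for a b
    using box[of b a] that by (simp add: algebra_simps)
  obtain a' b' where ab': "0 < a'" "a' < t" "0 < b'" "b' < t"
    "f (p + t *\<^sub>R w + t *\<^sub>R v) - f (p + t *\<^sub>R w) - f (p + t *\<^sub>R v) + f p
      = t * t * ?F (p + a' *\<^sub>R w + b' *\<^sub>R v)"
    using dd_second_difference[of S f w t p v] t box' f
    by (auto intro: Cinf_on_differentiable Cinf_on_dd)
  let ?q = "p + a *\<^sub>R v + b *\<^sub>R w" and ?q' = "p + b' *\<^sub>R v + a' *\<^sub>R w"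
  have "t * t * ?G ?q = t * t * ?F ?q'"
    using ab(5) ab'(5) by (simp add: algebra_simps)
  then have eq: "?G ?q = ?F ?q'" using t by simp
  have "dist (?G ?q) (?G p) < e" "dist (?F ?q') (?F p) < e"
    using near[of a b] near[of b' a'] ab ab' d1 d2 by (auto simp: d_def)
  then have "\<bar>?F p - ?G p\<bar> < 2 * e"
    unfolding eq dist_real_def by linarith
  then show False by (simp add: e_def)
qed

lemma pdx_commute:
  fixes f :: "real^2 \<Rightarrow> real"
  assumes "open S" "x \<in> S" "Cinf_on S f"
  shows "pdx i (pdx j f) x = pdx j (pdx i f) x"
  using dd_commute[OF assms] by (simp add: pdx_def[abs_def])

subsection \<open>The Lie derivative of the Schouten tensor\<close>

text \<open>In terms of jets at a point: \<open>K1 k i\<close>, \<open>K2 k i j\<close>, \<open>K3 k i j n\<close> are partial derivatives of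
$K^k$, \<open>G1 k i j m\<close> and \<open>G2 k i j m n\<close> those of $\Gamma^k_{ij}$, and \<open>r1 j n\<close> is $\partial_n \rho_j$.
The formula for \<open>P\<close> solves the defining equation of the Schouten tensor by taking traces.\<close>

lemma lie_schouten_jets:
  fixes K :: "2 \<Rightarrow> real" and K1 :: "2 \<Rightarrow> 2 \<Rightarrow> real" and K2 :: "2 \<Rightarrow> 2 \<Rightarrow> 2 \<Rightarrow> real"
    and K3 :: "2 \<Rightarrow> 2 \<Rightarrow> 2 \<Rightarrow> 2 \<Rightarrow> real"
    and G :: "2 \<Rightarrow> 2 \<Rightarrow> 2 \<Rightarrow> real" and G1 :: "2 \<Rightarrow> 2 \<Rightarrow> 2 \<Rightarrow> 2 \<Rightarrow> real"
    and G2 :: "2 \<Rightarrow> 2 \<Rightarrow> 2 \<Rightarrow> 2 \<Rightarrow> 2 \<Rightarrow> real"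
    and r :: "2 \<Rightarrow> real" and r1 :: "2 \<Rightarrow> 2 \<Rightarrow> real"
  assumes K2: "\<And>k i j. K2 k i j = K2 k j i"
    and K3: "\<And>k i j l. K3 k i j l = K3 k j i l" "\<And>k i j l. K3 k i j l = K3 k i l j"
    and G: "\<And>k i j. G k i j = G k j i"
    and G1: "\<And>k i j m. G1 k i j m = G1 k j i m"
    and G2: "\<And>k i j m n. G2 k i j m n = G2 k j i m n" "\<And>k i j m n. G2 k i j m n = G2 k i j n m"
    and E: "\<And>k i j. K2 k i j + (\<Sum>m\<in>UNIV. K m * G1 k i j m - G m i j * K1 k m + G k i m * K1 m j + G k j m * K1 m i)
        = kd i k * r j + kd j k * r i"
    and E1: "\<And>k i j n. K3 k i j n
        + (\<Sum>m\<in>UNIV. K1 m n * G1 k i j m + K m * G2 k i j m n - G1 m i j n * K1 k m - G m i j * K2 k n m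
          + G1 k i m n * K1 m j + G k i m * K2 m n j + G1 k j m n * K1 m i + G k j m * K2 m n i)
        = kd i k * r1 j n + kd j k * r1 i n"
    and R: "\<And>i j k l. R i j k l = G1 k j l i - G1 k i l j
        + (\<Sum>m\<in>UNIV. G k i m * G m j l - G k j m * G m i l)"
    and R1: "\<And>i j k l n. R1 i j k l n = G2 k j l i n - G2 k i l j n
        + (\<Sum>m\<in>UNIV. G1 k i m n * G m j l + G k i m * G1 m j l n - G1 k j m n * G m i l - G k j m * G1 m i l n)"
    and P: "\<And>j l. P j l = (2 * (\<Sum>k\<in>UNIV. R k j k l) + (\<Sum>k\<in>UNIV. R k l k j)) / 3"
    and P1: "\<And>j l n. P1 j l n = (2 * (\<Sum>k\<in>UNIV. R1 k j k l n) + (\<Sum>k\<in>UNIV. R1 k l k j n)) / 3"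
  shows "(\<Sum>m\<in>UNIV. K m * P1 j l m + P m l * K1 m j + P j m * K1 m l)
    = - r1 l j + (\<Sum>m\<in>UNIV. G m j l * r m)"
proof -
  \<comment> \<open>\<open>Ek\<close> is the Lie derivative of the connection along
    \<open>K\<close>, \<open>En\<close> its partial derivative in direction \<open>n\<close>, and
    \<open>LR\<close> the Lie derivative of the curvature. As abbreviations they allow a purely
    algebraic identity to be checked before the projective equation is inserted.\<close>
  define Ek where "Ek k i j = K2 k i j + (\<Sum>m\<in>UNIV. K m * G1 k i j m - G m i j * K1 k m + G k i m * K1 m j + G k j m * K1 m i)" for k i j
  define En where "En k i j n = K3 k i j n
        + (\<Sum>m\<in>UNIV. K1 m n * G1 k i j m + K m * G2 k i j m n - G1 m i j n * K1 k m - G m i j * K2 k n m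
          + G1 k i m n * K1 m j + G k i m * K2 m n j + G1 k j m n * K1 m i + G k j m * K2 m n i)" for k i j n
  define LR where "LR i j k l = (\<Sum>m\<in>UNIV. K m * R1 i j k l m + R m j k l * K1 m i + R i m k l * K1 m j
      - R i j m l * K1 k m + R i j k m * K1 m l)" for i j k l
  have G': "G k 2 1 = G k 1 2" for k by (rule G)
  have G1': "G1 k 2 1 m = G1 k 1 2 m" for k m by (rule G1)
  have G2': "G2 k 2 1 m n = G2 k 1 2 m n" "G2 k i j 2 1 = G2 k i j 1 2" for k i j m n
    by (rule G2)+
  have K2': "K2 k 2 1 = K2 k 1 2" for k by (rule K2)
  have K3': "K3 k 2 1 l = K3 k 1 2 l" "K3 k i 2 1 = K3 k i 1 2" for k i l by (rule K3)+
  \<comment> \<open>This is the skew covariant derivative of \<open>Ek\<close> in the indices 1 and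
    2. The correction terms that contract the differentiation index with the other lower index of
    the pair cancel by symmetry of \<open>G\<close>.\<close>
  have "\<forall>k l. LR 1 2 k l = En k 2 l 1 - En k 1 l 2
      + (\<Sum>m\<in>UNIV. G k 1 m * Ek m 2 l - G m 1 l * Ek k 2 m - G k 2 m * Ek m 1 l + G m 2 l * Ek k 1 m)"
    unfolding forall_2 LR_def En_def Ek_def R R1 sum_2 G' G1' G2' K2' K3'
    by (intro conjI; simp only: algebra_simps)
  then have LR12: "LR 1 2 k l = kd 2 k * r1 l 1 + kd l k * r1 2 1 - (kd 1 k * r1 l 2 + kd l k * r1 1 2)
      + (\<Sum>m\<in>UNIV. G k 1 m * (kd 2 m * r l + kd l m * r 2) - G m 1 l * (kd 2 k * r m + kd m k * r 2)
         - G k 2 m * (kd 1 m * r l + kd l m * r 1) + G m 2 l * (kd 1 k * r m + kd m k * r 1))" for k l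
    unfolding Ek_def En_def E E1 by blast
  \<comment> \<open>Skewness in the first two indices makes the pair (1,2) the only one to be
    computed.\<close>
  have Rskew: "R i j k l = - R j i k l" "R1 i j k l n = - R1 j i k l n" for i j k l n
    unfolding R R1 by (simp_all add: sum_2)
  have Rdiag: "R i i k l = 0" "R1 i i k l n = 0" for i k l n
    using Rskew(1)[of i i k l] Rskew(2)[of i i k l n] by simp_all
  have LR21: "LR 2 1 k l = - LR 1 2 k l" and LRd: "LR i i k l = 0" for i k l
    using Rskew[of 2 1] exhaust_2[of i] by (auto simp: LR_def sum_2 Rdiag)
  \<comment> \<open>Lie differentiation commutes with contraction, so the Lie derivative of
    \<open>P\<close> is the same combination of traces of \<open>LR\<close> as \<open>P\<close> is
    of \<open>R\<close>.\<close>
  have "(\<Sum>m\<in>UNIV. K m * P1 j l m + P m l * K1 m j + P j m * K1 m l)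
    = (2 * (\<Sum>k\<in>UNIV. LR k j k l) + (\<Sum>k\<in>UNIV. LR k l k j)) / 3"
    using exhaust_2[of j] exhaust_2[of l]
    by (auto simp: P P1 LR_def sum_2 Rdiag Rskew[of 2 1] field_simps)
  also have "\<dots> = - r1 l j + (\<Sum>m\<in>UNIV. G m j l * r m)"
    using exhaust_2[of j] exhaust_2[of l]
    by (auto simp: sum_2 LR21 LRd LR12 kd_def G' field_simps)
  finally show ?thesis .
qed

section \<open>Coordinate calculus on the base and on the cotangent bundle\<close>

lemma open_cotangent: "open U \<Longrightarrow> open (U \<times> (UNIV :: (real^2) set))"
  by (simp add: open_Times)

lemma bounded_linear_snd_nth: "bounded_linear (\<lambda>q::'a::real_normed_vector \<times> (real^'n). snd q $ j)"
  by (intro bounded_linear_vec_nth[THEN bounded_linear_compose] bounded_linear_snd)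

lemma Cinf_on_snd_nth: "Cinf_on S (\<lambda>q::'a::real_normed_vector \<times> (real^'n). snd q $ j)"
  by (rule Cinf_on_linear[OF bounded_linear_snd_nth])

lemma dd_snd_nth: "dd v (\<lambda>q::'a::real_normed_vector \<times> (real^'n). snd q $ j) p = snd v $ j"
  by (rule dd_linear[OF bounded_linear_snd_nth])

lemmas Cinf_on_intros = Cinf_on_const Cinf_on_add Cinf_on_diff Cinf_on_minus Cinf_on_mult
  Cinf_on_divide Cinf_on_sum Cinf_on_vec_nth Cinf_on_pdx Cinf_on_dd

lemmas pdx_rules =
  dd_add[where v = "axis i 1 :: real^2" for i, folded pdx_def]
  dd_diff[where v = "axis i 1 :: real^2" for i, folded pdx_def]
  dd_minus[where v = "axis i 1 :: real^2" for i, folded pdx_def]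
  dd_mult[where v = "axis i 1 :: real^2" for i, folded pdx_def]
  dd_divide[where v = "axis i 1 :: real^2" for i, folded pdx_def]
  dd_const[where v = "axis i 1 :: real^2" for i, folded pdx_def]

lemma pdx_cong_open:
  assumes "open S" "p \<in> S" "\<And>q. q \<in> S \<Longrightarrow> f q = g q"
  shows "pdx i f p = pdx i g p"
  unfolding pdx_def by (rule dd_cong_open[OF assms])

section \<open>Regularity of the Schouten tensor and derivatives of the projective equation\<close>

context
  fixes U :: "(real^2) set"
    and Gam :: "2 \<Rightarrow> 2 \<Rightarrow> 2 \<Rightarrow> real^2 \<Rightarrow> real"
    and P :: "2 \<Rightarrow> 2 \<Rightarrow> real^2 \<Rightarrow> real"
    and Lam :: real
  assumes U: "open U"
    and Gam: "\<And>k i j. Cinf_on U (Gam k i j)"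
    and Gam_sym: "\<And>x k i j. x \<in> U \<Longrightarrow> Gam k i j x = Gam k j i x"
    and P: "is_schouten U Gam P"
    and Lam: "Lam \<noteq> 0"
begin

lemma Cinf_on_curv: "Cinf_on U (curv Gam i j k l)"
  unfolding curv_def[abs_def] by (intro Cinf_on_intros U Gam)

text \<open>The trace of the curvature over \<open>k\<close> is
  \<open>2 * P j l x - P l j x\<close>; adding twice this to its transpose leaves
  \<open>3 * P j l x\<close>.\<close>

lemma schouten_eq:
  assumes "x \<in> U"
  shows "P j l x = (2 * (\<Sum>k\<in>UNIV. curv Gam k j k l x) + (\<Sum>k\<in>UNIV. curv Gam k l k j x)) / 3"
proof -
  have "curv Gam i j k l x = kd i k * P j l x - kd j k * P i l x - (P i j x - P j i x) * kd l k" for i j k l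
    using P assms by (simp add: is_schouten_def)
  then show ?thesis
    using exhaust_2[of j] exhaust_2[of l] by (auto simp: sum_2 kd_def)
qed

text \<open>Smoothness of \<open>P\<close> is inherited from \<open>Gam\<close> through the solved
  formula.\<close>

lemma Cinf_on_schouten: "Cinf_on U (P j l)"
  by (subst Cinf_on_cong[OF U schouten_eq]) (auto intro!: Cinf_on_intros U Cinf_on_curv)

lemma pdx_schouten_eq:
  assumes "x \<in> U"
  shows "pdx m (P j l) x
    = (2 * (\<Sum>k\<in>UNIV. pdx m (curv Gam k j k l) x) + (\<Sum>k\<in>UNIV. pdx m (curv Gam k l k j) x)) / 3"
proof -
  have "(\<lambda>x. curv Gam i j k l x) differentiable (at x)" for i j k l
    using Cinf_on_differentiable[OF Cinf_on_curv assms] .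
  then have "pdx m (\<lambda>x. (2 * (\<Sum>k\<in>UNIV. curv Gam k j k l x) + (\<Sum>k\<in>UNIV. curv Gam k l k j x)) / 3) x
    = (2 * (\<Sum>k\<in>UNIV. pdx m (curv Gam k j k l) x) + (\<Sum>k\<in>UNIV. pdx m (curv Gam k l k j) x)) / 3"
    by (simp add: sum_2 pdx_rules)
  then show ?thesis
    using pdx_cong_open[OF U assms schouten_eq] by simp
qed

lemma pdx_Gam_sym:
  assumes "x \<in> U"
  shows "pdx m (Gam k i j) x = pdx m (Gam k j i) x"
  by (rule pdx_cong_open[OF U assms Gam_sym])

lemma pdx_pdx_Gam_sym:
  assumes "x \<in> U"
  shows "pdx n (pdx m (Gam k i j)) x = pdx n (pdx m (Gam k j i)) x"
  by (rule pdx_cong_open[OF U assms pdx_Gam_sym])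

lemma pdx_curv:
  assumes "x \<in> U"
  shows "pdx n (curv Gam i j k l) x = pdx n (pdx i (Gam k j l)) x - pdx n (pdx j (Gam k i l)) x
    + (\<Sum>m\<in>UNIV. pdx n (Gam k i m) x * Gam m j l x + Gam k i m x * pdx n (Gam m j l) x
        - pdx n (Gam k j m) x * Gam m i l x - Gam k j m x * pdx n (Gam m i l) x)"
proof -
  have "Gam k i j differentiable (at x)" "pdx m (Gam k i j) differentiable (at x)" for k i j m
    by (intro Cinf_on_differentiable[OF _ assms] Cinf_on_pdx Gam)+
  then show ?thesis
    unfolding curv_def[abs_def] by (simp add: sum_2 pdx_rules)
qed

lemma lieGam_eq:
  "lieGam K Gam k i j x = pdx i (pdx j (\<lambda>z. K z $ k)) x
     + (\<Sum>m\<in>UNIV. K x $ m * pdx m (Gam k i j) x - Gam m i j x * pdx m (\<lambda>z. K z $ k) x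
        + Gam k i m x * pdx j (\<lambda>z. K z $ m) x + Gam k j m x * pdx i (\<lambda>z. K z $ m) x)"
  by (simp add: lieGam_def sum.distrib sum_subtractf)

lemma Cinf_on_lieGam:
  assumes "Cinf_on U K"
  shows "Cinf_on U (lieGam K Gam k i j)"
  unfolding lieGam_eq[abs_def] by (intro Cinf_on_intros U Gam assms)

lemma pdx_lieGam:
  assumes K: "Cinf_on U K" and x: "x \<in> U"
  shows "pdx n (lieGam K Gam k i j) x = pdx n (pdx i (pdx j (\<lambda>z. K z $ k))) x
     + (\<Sum>m\<in>UNIV. pdx n (\<lambda>z. K z $ m) x * pdx m (Gam k i j) x + K x $ m * pdx n (pdx m (Gam k i j)) x
        - pdx n (Gam m i j) x * pdx m (\<lambda>z. K z $ k) x - Gam m i j x * pdx n (pdx m (\<lambda>z. K z $ k)) x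
        + pdx n (Gam k i m) x * pdx j (\<lambda>z. K z $ m) x + Gam k i m x * pdx n (pdx j (\<lambda>z. K z $ m)) x
        + pdx n (Gam k j m) x * pdx i (\<lambda>z. K z $ m) x + Gam k j m x * pdx n (pdx i (\<lambda>z. K z $ m)) x)"
proof -
  have "Gam k i j differentiable (at x)" "pdx m (Gam k i j) differentiable (at x)"
    "(\<lambda>z. K z $ k) differentiable (at x)" "pdx m (\<lambda>z. K z $ k) differentiable (at x)"
    "pdx n (pdx m (\<lambda>z. K z $ k)) differentiable (at x)" for k i j m n
    by (intro Cinf_on_differentiable[OF _ x] Cinf_on_intros U Gam K)+
  then show ?thesis
    unfolding lieGam_eq[abs_def] by (simp add: sum_2 pdx_rules)
qed

text \<open>Taking all three indices equal, without summation, turns the projective equation into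
  \<open>lieGam K Gam k k k x = 2 * rho x $ k\<close>, so \<open>rho\<close> inherits its smoothness
  from \<open>K\<close> and \<open>Gam\<close>.\<close>

lemma Cinf_on_projective_form:
  assumes "projective_with U Gam K rho"
  shows "Cinf_on U rho"
proof -
  have K: "Cinf_on U K" and eq: "\<And>x i j k. x \<in> U \<Longrightarrow> lieGam K Gam k i j x = kd i k * rho x $ j + kd j k * rho x $ i"
    using assms by (auto simp: projective_with_def)
  have "rho x = (\<chi> k. lieGam K Gam k k k x / 2)" if "x \<in> U" for x
    using eq[OF that] by (simp add: vec_eq_iff kd_def)
  then have "Cinf_on U rho \<longleftrightarrow> Cinf_on U (\<lambda>x. \<chi> k. lieGam K Gam k k k x / 2)"
    by (rule Cinf_on_cong[OF U])
  then show ?thesis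
    by (simp add: Cinf_on_vec_lambda Cinf_on_divide Cinf_on_lieGam K U)
qed

text \<open>The components of $\mathcal{L}_K P_{ij} + \nabla_i\rho_j$.\<close>

definition schouten_defect :: "(real^2 \<Rightarrow> real^2) \<Rightarrow> (real^2 \<Rightarrow> real^2) \<Rightarrow> 2 \<Rightarrow> 2 \<Rightarrow> real^2 \<Rightarrow> real" where
  "schouten_defect K rho i j x =
    (\<Sum>m\<in>UNIV. K x $ m * pdx m (P i j) x + P m j x * pdx i (\<lambda>z. K z $ m) x + P i m x * pdx j (\<lambda>z. K z $ m) x)
    + pdx i (\<lambda>z. rho z $ j) x - (\<Sum>m\<in>UNIV. Gam m i j x * rho x $ m)"

text \<open>The jet identity applies at \<open>x\<close>: the projective equation holds on the open
  set \<open>U\<close> and may therefore be differentiated, and the symmetries required of the jets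
  come from commuting partial derivatives and from the symmetry of \<open>Gam\<close>.\<close>

lemma schouten_defect_projective:
  assumes proj: "projective_with U Gam K rho" and x: "x \<in> U"
  shows "schouten_defect K rho i j x = 0"
proof -
  have K: "Cinf_on U K" and eq: "\<And>x i j k. x \<in> U \<Longrightarrow> lieGam K Gam k i j x = kd i k * rho x $ j + kd j k * rho x $ i"
    using proj by (auto simp: projective_with_def)
  have rho: "Cinf_on U rho" by (rule Cinf_on_projective_form[OF proj])
  have Kk: "Cinf_on U (\<lambda>z. K z $ k)" for k by (rule Cinf_on_vec_nth[OF U K])
  have deq: "pdx n (lieGam K Gam k i j) x = kd i k * pdx n (\<lambda>z. rho z $ j) x + kd j k * pdx n (\<lambda>z. rho z $ i) x" for n i j k
  proof -
    have "(\<lambda>z. rho z $ i) differentiable (at x)" for i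
      by (intro Cinf_on_differentiable[OF _ x] Cinf_on_vec_nth U rho)
    then show ?thesis
      using pdx_cong_open[OF U x eq] by (simp add: pdx_rules)
  qed
  have K2: "pdx i (pdx j (\<lambda>z. K z $ k)) y = pdx j (pdx i (\<lambda>z. K z $ k)) y" if "y \<in> U" for i j k y
    by (rule pdx_commute[OF U that Kk])
  have K3: "pdx n (pdx i (pdx j (\<lambda>z. K z $ k))) x = pdx n (pdx j (pdx i (\<lambda>z. K z $ k))) x" for i j k n
    by (rule pdx_cong_open[OF U x K2])
  \<comment> \<open>The innermost and outermost derivatives are exchanged by successive swaps of
    neighbours.\<close>
  have K3': "pdx n (pdx i (pdx j (\<lambda>z. K z $ k))) x = pdx j (pdx i (pdx n (\<lambda>z. K z $ k))) x" for i j k n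
    by (metis K3 pdx_commute[OF U x Cinf_on_pdx[OF Kk]])
  have G2: "pdx n (pdx m (Gam k i j)) x = pdx m (pdx n (Gam k i j)) x" for i j k m n
    by (rule pdx_commute[OF U x Gam])
  note eq' = eq[OF x, unfolded lieGam_eq] and deq' = deq[unfolded pdx_lieGam[OF K x]]
  have "(\<Sum>m\<in>UNIV. K x $ m * pdx m (P i j) x + P m j x * pdx i (\<lambda>z. K z $ m) x + P i m x * pdx j (\<lambda>z. K z $ m) x)
    = - pdx i (\<lambda>z. rho z $ j) x + (\<Sum>m\<in>UNIV. Gam m i j x * rho x $ m)"
    by (rule lie_schouten_jets[where ?K2.0 = "\<lambda>k i j. pdx i (pdx j (\<lambda>z. K z $ k)) x"
        and ?K3.0 = "\<lambda>k i j n. pdx n (pdx i (pdx j (\<lambda>z. K z $ k))) x"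
        and ?G1.0 = "\<lambda>k i j m. pdx m (Gam k i j) x"
        and ?G2.0 = "\<lambda>k i j m n. pdx n (pdx m (Gam k i j)) x"
        and R = "\<lambda>i j k l. curv Gam i j k l x" and ?R1.0 = "\<lambda>i j k l n. pdx n (curv Gam i j k l) x"])
      (rule K2[OF x] K3 K3' Gam_sym[OF x] pdx_Gam_sym[OF x] pdx_pdx_Gam_sym[OF x] G2 eq' deq' curv_def
      pdx_curv[OF x] schouten_eq[OF x] pdx_schouten_eq[OF x])+
  then show ?thesis by (simp add: schouten_defect_def)
qed

subsection \<open>Lifted vector fields\<close>

lemma Cinf_on_lift:
  assumes K: "Cinf_on U K" and rho: "Cinf_on U rho"
  shows "Cinf_on (U \<times> UNIV) (lift K rho Lam)"
proof -
  note S = open_cotangent[OF U]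
  have "Cinf_on (U \<times> UNIV) (\<lambda>q. - (\<Sum>j\<in>UNIV. snd q $ j * pdx i (\<lambda>z. K z $ j) (fst q)) + rho (fst q) $ i / Lam)" for i
    by (intro Cinf_on_intros Cinf_on_compose_fst S Cinf_on_snd_nth U K rho
        Cinf_on_compose_fst[where f = "\<lambda>x. rho x $ i / Lam"])
  then show ?thesis
    unfolding lift_def[abs_def]
    by (intro Cinf_on_Pair Cinf_on_vec_lambda S Cinf_on_compose_fst K)
qed

lemma dd_lift:
  assumes K: "Cinf_on U K" and rho: "Cinf_on U rho" and p: "fst p \<in> U"
  shows "dd v (lift K rho Lam) p = (\<chi> i. \<Sum>m\<in>UNIV. fst v $ m * pdx m (\<lambda>z. K z $ i) (fst p),
    \<chi> i. - (\<Sum>j\<in>UNIV. snd v $ j * pdx i (\<lambda>z. K z $ j) (fst p)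
          + snd p $ j * (\<Sum>m\<in>UNIV. fst v $ m * pdx m (pdx i (\<lambda>z. K z $ j)) (fst p)))
        + (\<Sum>m\<in>UNIV. fst v $ m * pdx m (\<lambda>z. rho z $ i) (fst p)) / Lam)"
proof -
  have p': "p \<in> U \<times> UNIV" using p by (cases p) auto
  have d: "lift K rho Lam differentiable (at p)"
    by (rule Cinf_on_differentiable[OF Cinf_on_lift[OF K rho] p'])
  have Kd: "(\<lambda>z. K z $ k) differentiable (at (fst p))" "pdx m (\<lambda>z. K z $ k) differentiable (at (fst p))"
    "(\<lambda>z. rho z $ k) differentiable (at (fst p))" for k m
    by (intro Cinf_on_differentiable[OF _ p] Cinf_on_intros U K rho)+
  have lifted: "(\<lambda>q. f (fst q)) differentiable (at p)" if "Cinf_on U f" for f :: "real^2 \<Rightarrow> real"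
    by (rule Cinf_on_differentiable[OF Cinf_on_compose_fst[OF that] p'])
  have Kd': "(\<lambda>q. pdx m (\<lambda>z. K z $ k) (fst q)) differentiable (at p)"
    "(\<lambda>q. rho (fst q) $ k) differentiable (at p)" "(\<lambda>q. snd q $ k) differentiable (at p)" for k m
    by (rule lifted lifted[where f = "\<lambda>x. rho x $ k"] Cinf_on_intros U K rho
        Cinf_on_differentiable[OF Cinf_on_snd_nth p'])+
  have "fst (dd v (lift K rho Lam) p) $ i = (\<Sum>m\<in>UNIV. fst v $ m * pdx m (\<lambda>z. K z $ i) (fst p))" for i
  proof -
    have "fst (dd v (lift K rho Lam) p) $ i = dd v (\<lambda>q. fst (lift K rho Lam q) $ i) p"
      using d by (simp add: dd_fst dd_vec_nth differentiable_bounded_linear[OF bounded_linear_fst])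
    also have "\<dots> = dd (fst v) (\<lambda>z. K z $ i) (fst p)"
      by (simp add: lift_def dd_compose_fst[where f = "\<lambda>z. K z $ i"])
    finally show ?thesis by (simp add: dd_eq_sum_pdx[OF Kd(1)])
  qed
  moreover have "snd (dd v (lift K rho Lam) p) $ i = - (\<Sum>j\<in>UNIV. snd v $ j * pdx i (\<lambda>z. K z $ j) (fst p)
          + snd p $ j * (\<Sum>m\<in>UNIV. fst v $ m * pdx m (pdx i (\<lambda>z. K z $ j)) (fst p)))
        + (\<Sum>m\<in>UNIV. fst v $ m * pdx m (\<lambda>z. rho z $ i) (fst p)) / Lam" for i
  proof -
    have "snd (dd v (lift K rho Lam) p) $ i = dd v (\<lambda>q. snd (lift K rho Lam q) $ i) p"
      using d by (simp add: dd_snd dd_vec_nth differentiable_bounded_linear[OF bounded_linear_snd])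
    also have "\<dots> = dd v (\<lambda>q. - (\<Sum>j\<in>UNIV. snd q $ j * pdx i (\<lambda>z. K z $ j) (fst q)) + rho (fst q) $ i / Lam) p"
      by (simp add: lift_def)
    also have "\<dots> = - (\<Sum>j\<in>UNIV. snd p $ j * dd v (\<lambda>q. pdx i (\<lambda>z. K z $ j) (fst q)) p
        + snd v $ j * pdx i (\<lambda>z. K z $ j) (fst p)) + dd v (\<lambda>q. rho (fst q) $ i) p / Lam"
      unfolding sum_2 using Kd' Lam
      by (simp add: dd_add dd_diff dd_minus dd_mult dd_divide dd_snd_nth)
    finally show ?thesis
      by (simp add: dd_compose_fst[where f = "\<lambda>z. rho z $ i"] dd_compose_fst dd_eq_sum_pdx Kd sum_2)
  qed
  ultimately show ?thesis
    by (simp add: prod_eq_iff vec_eq_iff)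
qed

section \<open>Lie derivatives of the metric and of the 2-form\<close>

lemma Cinf_on_Aterm: "Cinf_on (U \<times> UNIV) (\<lambda>q. Aterm Gam P Lam i j (fst q) (snd q))"
  unfolding Aterm_def
  by (intro Cinf_on_intros open_cotangent U Cinf_on_snd_nth Cinf_on_compose_fst Gam Cinf_on_schouten)

lemma dd_Aterm:
  assumes p: "fst p \<in> U"
  shows "dd v (\<lambda>q. Aterm Gam P Lam i j (fst q) (snd q)) p
    = (\<Sum>k\<in>UNIV. Gam k i j (fst p) * snd v $ k + (\<Sum>m\<in>UNIV. fst v $ m * pdx m (Gam k i j) (fst p)) * snd p $ k)
      - Lam * (snd p $ i * snd v $ j + snd v $ i * snd p $ j)
      - (\<Sum>m\<in>UNIV. fst v $ m * pdx m (P j i) (fst p)) / Lam"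
proof -
  have p': "p \<in> U \<times> UNIV" using p by (cases p) auto
  have d: "(\<lambda>q. snd q $ k) differentiable (at p)" "(\<lambda>q. Gam k i j (fst q)) differentiable (at p)"
    "(\<lambda>q. P i j (fst q)) differentiable (at p)" for k i j
    by (intro Cinf_on_differentiable[OF _ p'] Cinf_on_snd_nth Cinf_on_compose_fst Gam Cinf_on_schouten)+
  have d': "Gam k i j differentiable (at (fst p))" "P i j differentiable (at (fst p))" for k i j
    by (intro Cinf_on_differentiable[OF _ p] Gam Cinf_on_schouten)+
  show ?thesis
    unfolding Aterm_def
    using Lam by (simp add: dd_add dd_diff dd_mult dd_divide sum_2 d dd_snd_nth dd_compose_fst dd_eq_sum_pdx d' algebra_simps)
qed

text \<open>On constant \<open>v\<close> and \<open>w\<close> the part of the metric pairing fibre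
  with base components has constant coefficients, so differentiating the coefficients only meets
  \<open>Aterm\<close>.\<close>

lemma lie2_gmet:
  assumes p: "fst p \<in> U"
  shows "lie2 (gmet Gam P Lam) V p v w
    = gmet Gam P Lam p (dd v V p) w + gmet Gam P Lam p v (dd w V p)
      - (1/2) * (\<Sum>i\<in>UNIV. \<Sum>j\<in>UNIV. dd (V p) (\<lambda>q. Aterm Gam P Lam i j (fst q) (snd q)) p
          * (fst v $ j * fst w $ i + fst w $ j * fst v $ i))"
proof -
  have "p \<in> U \<times> UNIV" using p by (cases p) auto
  then have d: "(\<lambda>q. Aterm Gam P Lam i j (fst q) (snd q)) differentiable (at p)" for i j
    using Cinf_on_differentiable[OF Cinf_on_Aterm] by blast
  have "dd u (\<lambda>q. gmet Gam P Lam q v w) p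
    = - (1/2) * (\<Sum>i\<in>UNIV. \<Sum>j\<in>UNIV. dd u (\<lambda>q. Aterm Gam P Lam i j (fst q) (snd q)) p
          * (fst v $ j * fst w $ i + fst w $ j * fst v $ i))" for u
    unfolding gmet_def
    by (simp add: dd_add dd_diff dd_mult dd_divide sum_2 d) (simp add: algebra_simps)
  then show ?thesis by (simp add: lie2_def)
qed

text \<open>The cotangent lift of \<open>K\<close> preserves the tautological 1-form, so the
  quadratic part of \<open>Aterm\<close> contributes only through the shift by
  \<open>rho / Lam\<close>, which yields the \<open>kd\<close> terms; the same shift in the
  \<open>Gam\<close> part completes the derivative of \<open>rho\<close> to a covariant one.
  \<open>K\<close> and \<open>rho\<close> are arbitrary smooth fields because the converse uses the
  formula before \<open>K\<close> is known to be projective.\<close>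

lemma lie2_gmet_lift:
  assumes K: "Cinf_on U K" and rho: "Cinf_on U rho" and p: "fst p \<in> U"
  shows "lie2 (gmet Gam P Lam) (lift K rho Lam) p v w
    = (\<Sum>i\<in>UNIV. \<Sum>j\<in>UNIV. fst v $ i * fst w $ j *
        ((schouten_defect K rho i j (fst p) + schouten_defect K rho j i (fst p)) / (2 * Lam)
        - (\<Sum>k\<in>UNIV. snd p $ k * (lieGam K Gam k i j (fst p) - kd i k * rho (fst p) $ j - kd j k * rho (fst p) $ i))))"
proof -
  let ?x = "fst p"
  have G: "Gam k 2 1 ?x = Gam k 1 2 ?x" for k by (rule Gam_sym[OF p])
  have G1: "pdx m (Gam k 2 1) ?x = pdx m (Gam k 1 2) ?x" for k m by (rule pdx_Gam_sym[OF p])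
  have K2: "pdx 2 (pdx 1 (\<lambda>z. K z $ k)) ?x = pdx 1 (pdx 2 (\<lambda>z. K z $ k)) ?x" for k
    by (rule pdx_commute[OF U p Cinf_on_vec_nth[OF U K]])
  have L: "fst (lift K rho Lam p) = K ?x"
    "snd (lift K rho Lam p) $ i = - (\<Sum>j\<in>UNIV. snd p $ j * pdx i (\<lambda>z. K z $ j) ?x) + rho ?x $ i / Lam" for i
    by (simp_all add: lift_def)
  \<comment> \<open>Absorbing \<open>1 / Lam\<close> into \<open>s\<close>, \<open>Q\<close> and
    their derivatives makes the identity polynomial; \<open>e\<close> is the defect divided by
    \<open>Lam\<close>.\<close>
  define s where "s i = rho ?x $ i / Lam" for i
  define s1 where "s1 m i = pdx m (\<lambda>z. rho z $ i) ?x / Lam" for m i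
  define Q where "Q i j = P i j ?x / Lam" for i j
  define Q1 where "Q1 m i j = pdx m (P i j) ?x / Lam" for m i j
  define e where "e i j = (\<Sum>m\<in>UNIV. K ?x $ m * Q1 m i j + Q m j * pdx i (\<lambda>z. K z $ m) ?x
      + Q i m * pdx j (\<lambda>z. K z $ m) ?x) + s1 i j - (\<Sum>m\<in>UNIV. Gam m i j ?x * s m)" for i j
  have e: "(schouten_defect K rho i j ?x + schouten_defect K rho j i ?x) / (2 * Lam) = (e i j + e j i) / 2" for i j
    by (simp add: schouten_defect_def e_def Q_def Q1_def s_def s1_def sum_2 add_divide_distrib diff_divide_distrib)
  have rho_s: "rho ?x $ i = Lam * s i" for i
    using Lam by (simp add: s_def)
  have dQ: "(\<Sum>m\<in>UNIV. c m * pdx m (P i j) ?x) / Lam = (\<Sum>m\<in>UNIV. c m * Q1 m i j)" for c i j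
    by (simp add: sum_2 Q1_def add_divide_distrib)
  have ds: "(\<Sum>m\<in>UNIV. c m * pdx m (\<lambda>z. rho z $ i) ?x) / Lam = (\<Sum>m\<in>UNIV. c m * s1 m i)" for c i
    by (simp add: sum_2 s1_def add_divide_distrib)
  have half: "2 * (1/2 * a + 1/2 * b - 1/2 * c) = a + b - c" for a b c :: real
    by simp
  have half': "2 * (\<Sum>i\<in>UNIV. \<Sum>j\<in>UNIV. c i j * ((e i j + e j i) / 2 - t i j))
    = (\<Sum>i\<in>UNIV. \<Sum>j\<in>UNIV. c i j * (e i j + e j i - 2 * t i j))" for c t :: "2 \<Rightarrow> 2 \<Rightarrow> real"
    by (simp add: sum_2 field_simps)
  have "2 * lie2 (gmet Gam P Lam) (lift K rho Lam) p v w
    = 2 * (\<Sum>i\<in>UNIV. \<Sum>j\<in>UNIV. fst v $ i * fst w $ j * ((e i j + e j i) / 2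
        - (\<Sum>k\<in>UNIV. snd p $ k * (lieGam K Gam k i j ?x - kd i k * rho ?x $ j - kd j k * rho ?x $ i))))"
    unfolding lie2_gmet[OF p] dd_lift[OF K rho p] gmet_def dd_Aterm[OF p] L half half'
      lieGam_eq dQ ds fst_conv snd_conv vec_lambda_beta
    unfolding Aterm_def Q_def[symmetric] s_def[symmetric] rho_s e_def sum_2
    using Lam by (simp add: G G1 K2 kd_def) (simp add: algebra_simps)
  then show ?thesis by (simp only: e mult_cancel_left) simp
qed

text \<open>The canonical 2-form is preserved by the cotangent lift, and the shift adds the exterior
  derivative of \<open>rho / Lam\<close>. With the Lie derivative of the \<open>P\<close> term this
  is the skew part of the defect, where the \<open>Gam\<close> terms cancel.\<close>

lemma lie2_omega_lift:
  assumes K: "Cinf_on U K" and rho: "Cinf_on U rho" and p: "fst p \<in> U"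
  shows "lie2 (omega P Lam) (lift K rho Lam) p v w
    = (\<Sum>i\<in>UNIV. \<Sum>j\<in>UNIV. fst v $ i * fst w $ j *
        (schouten_defect K rho i j (fst p) - schouten_defect K rho j i (fst p)) / Lam)"
proof -
  let ?x = "fst p"
  define mu where "mu = 1 / Lam"
  have div: "c / Lam = c * mu" for c
    by (simp add: mu_def)
  have p': "p \<in> U \<times> UNIV" using p by (cases p) auto
  have d: "(\<lambda>q. P i j (fst q)) differentiable (at p)" for i j
    by (rule Cinf_on_differentiable[OF Cinf_on_compose_fst[OF Cinf_on_schouten] p'])
  have d': "P i j differentiable (at ?x)" for i j
    by (rule Cinf_on_differentiable[OF Cinf_on_schouten p])
  have G: "Gam k 2 1 ?x = Gam k 1 2 ?x" for k by (rule Gam_sym[OF p])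
  have K2: "pdx 2 (pdx 1 (\<lambda>z. K z $ k)) ?x = pdx 1 (pdx 2 (\<lambda>z. K z $ k)) ?x" for k
    by (rule pdx_commute[OF U p Cinf_on_vec_nth[OF U K]])
  have "dd u (\<lambda>q. omega P Lam q v w) p = (1 / Lam) * (\<Sum>i\<in>UNIV. \<Sum>j\<in>UNIV.
      (\<Sum>m\<in>UNIV. fst u $ m * pdx m (P i j) ?x) * (fst v $ i * fst w $ j - fst w $ i * fst v $ j))" for u
    unfolding omega_def using Lam
    by (simp add: dd_add dd_diff dd_mult dd_divide sum_2 d dd_compose_fst dd_eq_sum_pdx d')
  moreover have "fst (lift K rho Lam p) = K ?x"
    by (simp add: lift_def)
  ultimately show ?thesis
    unfolding lie2_def dd_lift[OF K rho p] omega_def schouten_defect_def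
    by (simp add: sum_2 G K2 div) (simp add: algebra_simps)
qed

subsection \<open>Killing vector fields\<close>

text \<open>The fibres are null and \<open>Aterm\<close> multiplies base components only, so just
  the base part of \<open>V\<close> enters. For a Killing field its fibre derivative is thus
  skew.\<close>

lemma lie2_gmet_vertical:
  assumes p: "fst p \<in> U"
  shows "lie2 (gmet Gam P Lam) V p (0, axis i 1) (0, axis j 1)
    = (fst (dd (0, axis i 1) V p) $ j + fst (dd (0, axis j 1) V p) $ i) / 2"
  using exhaust_2[of i] exhaust_2[of j]
  unfolding lie2_gmet[OF p] gmet_def by (auto simp: sum_2 axis_def)

text \<open>For a Killing field this determines the fibre derivatives of the covector part from
  derivatives of the base part.\<close>

lemma lie2_gmet_mixed:
  assumes p: "fst p \<in> U"
  shows "2 * lie2 (gmet Gam P Lam) V p (0, axis i 1) (axis j 1, 0)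
    = snd (dd (0, axis i 1) V p) $ j + fst (dd (axis j 1, 0) V p) $ i
      - (\<Sum>k\<in>UNIV. (Aterm Gam P Lam j k (fst p) (snd p) + Aterm Gam P Lam k j (fst p) (snd p))
          * fst (dd (0, axis i 1) V p) $ k)"
  using exhaust_2[of i] exhaust_2[of j]
  unfolding lie2_gmet[OF p] gmet_def by (auto simp: sum_2 axis_def algebra_simps)

text \<open>The fibre is all of the plane, so the segment from 0 to \<open>xi\<close> stays in the
  domain, and \<open>f\<close> has zero derivative along it.\<close>

lemma constant_on_fibre:
  fixes f :: "(real^2) \<times> (real^2) \<Rightarrow> real"
  assumes f: "Cinf_on (U \<times> UNIV) f" and x: "x \<in> U"
    and vert: "\<And>i xi. dd (0, axis i 1) f (x, xi) = 0"
  shows "f (x, xi) = f (x, 0)"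
proof -
  have d: "f differentiable (at (x, eta))" for eta
    using Cinf_on_differentiable[OF f] x by simp
  have zero: "dd (0, xi) f (x, eta) = 0" for eta
  proof -
    interpret D: linear "\<lambda>v. dd v f (x, eta)"
      using has_derivative_dd[OF d] has_derivative_linear by blast
    have "(0, xi) = (\<Sum>i\<in>UNIV. xi $ i *\<^sub>R ((0, axis i 1) :: (real^2) \<times> (real^2)))"
      by (simp add: sum_2 prod_eq_iff vec_eq_iff forall_2 axis_def)
    then have "dd (0, xi) f (x, eta) = (\<Sum>i\<in>UNIV. xi $ i *\<^sub>R dd (0, axis i 1) f (x, eta))"
      by (simp only: D.sum D.scale)
    then show ?thesis by (simp add: vert)
  qed
  have "((\<lambda>t. f ((x, 0) + t *\<^sub>R (0, xi))) has_real_derivative 0) (at t)" for t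
    using has_vector_derivative_dd_line[of f "(x, 0)" t "(0, xi)"] d zero
    by (simp add: has_real_derivative_iff_has_vector_derivative)
  then have "f ((x, 0) + 1 *\<^sub>R (0, xi)) = f ((x, 0) + 0 *\<^sub>R (0, xi))"
    using DERIV_isconst_all[of "\<lambda>t. f ((x, 0) + t *\<^sub>R (0, xi))" 1 0] by blast
  then show ?thesis by simp
qed

lemma lie2_cong_open:
  assumes "open S" "p \<in> S" "\<And>q. q \<in> S \<Longrightarrow> V q = W q"
  shows "lie2 T V p v w = lie2 T W p v w"
  unfolding lie2_def using dd_cong_open[OF assms] assms(2,3) by simp

text \<open>The \<open>xi\<close> terms of a lift vanish on the zero section, where it equals
  \<open>(K x, (1 / Lam) *\<^sub>R rho x)\<close>; this forces the choice of \<open>K\<close> and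
  \<open>rho\<close>.\<close>

lemma killing_imp_lift:
  assumes kill: "killing (U \<times> UNIV) (gmet Gam P Lam) V"
  defines "K \<equiv> \<lambda>x. fst (V (x, 0))" and "rho \<equiv> \<lambda>x. Lam *\<^sub>R snd (V (x, 0))"
  shows "projective_with U Gam K rho" and "p \<in> U \<times> UNIV \<Longrightarrow> V p = lift K rho Lam p"
proof -
  let ?S = "U \<times> (UNIV :: (real^2) set)"
  have S: "open ?S" by (rule open_cotangent[OF U])
  have V: "Cinf_on ?S V" and lie0: "\<And>p v w. p \<in> ?S \<Longrightarrow> lie2 (gmet Gam P Lam) V p v w = 0"
    using kill by (auto simp: killing_def)
  \<comment> \<open>\<open>X\<close> and \<open>W\<close> are the base and fibre components of
    \<open>V\<close>; \<open>h i\<close> and \<open>b i\<close> are the coordinate directions of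
    \<open>xi\<close> and of \<open>x\<close>.\<close>
  define X where "X i q = fst (V q) $ i" for i q
  define W where "W i q = snd (V q) $ i" for i q
  define h :: "2 \<Rightarrow> (real^2) \<times> (real^2)" where "h i = (0, axis i 1)" for i
  define b :: "2 \<Rightarrow> (real^2) \<times> (real^2)" where "b i = (axis i 1, 0)" for i
  define A where "A i j q = Aterm Gam P Lam i j (fst q) (snd q)" for i j q
  have smooth: "Cinf_on ?S (X i)" "Cinf_on ?S (W i)" for i
    unfolding X_def W_def
    by (intro Cinf_on_vec_nth S Cinf_on_bounded_linear[OF S bounded_linear_fst V]
        Cinf_on_bounded_linear[OF S bounded_linear_snd V])+
  have A: "Cinf_on ?S (A i j)" for i j
    unfolding A_def by (rule Cinf_on_Aterm)
  note diff = Cinf_on_differentiable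
  have dV: "fst (dd v V p) $ i = dd v (X i) p" "snd (dd v V p) $ i = dd v (W i) p" if "p \<in> ?S" for v p i
    using diff[OF V that]
    by (simp_all add: X_def[abs_def] W_def[abs_def] dd_fst dd_snd dd_vec_nth
        differentiable_bounded_linear[OF bounded_linear_fst] differentiable_bounded_linear[OF bounded_linear_snd])
  have comm: "dd v (dd w f) p = dd w (dd v f) p" if "p \<in> ?S" "Cinf_on ?S f" for v w p and f :: "(real^2) \<times> (real^2) \<Rightarrow> real"
    by (rule dd_commute[OF S that])
  have vert: "dd (h i) (X j) p = - dd (h j) (X i) p" if "p \<in> ?S" for i j p
  proof -
    have "fst p \<in> U" using that by auto
    from lie2_gmet_vertical[OF this, of V i j] show ?thesis
      by (simp add: lie0[OF that] dV[OF that] h_def)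
  qed
  have diag: "dd (h i) (X i) p = 0" if "p \<in> ?S" for i p
    using vert[OF that, of i i] by simp
  have mixed: "dd (h i) (W j) p = (\<Sum>k\<in>UNIV. (A j k p + A k j p) * dd (h i) (X k) p) - dd (b j) (X i) p"
    if "p \<in> ?S" for i j p
  proof -
    have "fst p \<in> U" using that by auto
    from lie2_gmet_mixed[OF this, of V i j] show ?thesis
      by (simp add: lie0[OF that] dV[OF that] h_def b_def A_def)
  qed
  \<comment> \<open>A skew 2 by 2 fibre derivative has a single independent entry.\<close>
  define c where "c = dd (h 2) (X 1)"
  have c: "Cinf_on ?S c" unfolding c_def by (intro Cinf_on_dd smooth)
  have c_eq: "dd (h 1) (X 2) q = - c q" if "q \<in> ?S" for q
    using vert[OF that, of 1 2] by (simp add: c_def)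
  \<comment> \<open>Up to sign \<open>c\<close> is a derivative of either \<open>X 1\<close> or
    \<open>X 2\<close>; exchanging derivatives reduces each fibre derivative of \<open>c\<close> to
    that of a vanishing diagonal entry.\<close>
  have c_vert: "dd (h i) c p = 0" if p: "p \<in> ?S" for i p
  proof -
    have "dd (h 1) c p = dd (h 2) (dd (h 1) (X 1)) p"
      unfolding c_def by (rule comm[OF p smooth(1)])
    also have "\<dots> = dd (h 2) (\<lambda>q. 0) p"
      by (rule dd_cong_open[OF S p diag])
    finally have 1: "dd (h 1) c p = 0" by simp
    have "dd (h 2) c p = dd (h 2) (\<lambda>q. - dd (h 1) (X 2) q) p"
      by (rule dd_cong_open[OF S p]) (simp add: c_eq)
    also have "\<dots> = - dd (h 2) (dd (h 1) (X 2)) p"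
      by (intro dd_minus diff[OF _ p] Cinf_on_dd smooth)
    also have "dd (h 2) (dd (h 1) (X 2)) p = dd (h 1) (dd (h 2) (X 2)) p"
      by (rule comm[OF p smooth(1)])
    also have "\<dots> = dd (h 1) (\<lambda>q. 0) p"
      by (rule dd_cong_open[OF S p diag])
    finally show ?thesis using 1 exhaust_2[of i] by auto
  qed
  \<comment> \<open>Compatibility of the two fibre derivatives of \<open>W 1\<close> prescribed by
    \<open>mixed\<close>. After halving, the coefficient 3 collects 2 from \<open>A 1 1\<close> and
    1 from \<open>A 1 2\<close> and \<open>A 2 1\<close> together.\<close>
  have integrability: "dd (b 1) c p + c p * (Gam 1 1 1 (fst p) + Gam 2 1 2 (fst p) - 3 * Lam * snd p $ 1) = 0"
    if p: "p \<in> ?S" for p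
  proof -
    have A_d: "dd (h l) (A i j) p = Gam l i j (fst p) - Lam * (snd p $ i * kd l j + kd l i * snd p $ j)" for l i j
      using exhaust_2[of l] p dd_Aterm[of p "h l" i j]
      by (auto simp: A_def[abs_def] h_def sum_2 kd_def axis_def)
    have Ap: "A i j differentiable (at p)" "c differentiable (at p)" "dd v (X i) differentiable (at p)" for i j v
      by (intro diff[OF _ p] A c Cinf_on_dd smooth)+
    have "dd (h 2) (W 1) q = (A 1 1 q + A 1 1 q) * c q - dd (b 1) (X 2) q" if "q \<in> ?S" for q
      unfolding mixed[OF that] sum_2 diag[OF that] by (simp add: c_def)
    then have "dd (h 1) (dd (h 2) (W 1)) p = dd (h 1) (\<lambda>q. (A 1 1 q + A 1 1 q) * c q - dd (b 1) (X 2) q) p"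
      by (rule dd_cong_open[OF S p])
    also have "\<dots> = 2 * dd (h 1) (A 1 1) p * c p - dd (h 1) (dd (b 1) (X 2)) p"
      by (simp add: dd_diff dd_mult dd_add Ap c_vert[OF p])
    also have "dd (h 1) (dd (b 1) (X 2)) p = dd (b 1) (dd (h 1) (X 2)) p"
      by (rule comm[OF p smooth(1)])
    also have "\<dots> = dd (b 1) (\<lambda>q. - c q) p"
      by (rule dd_cong_open[OF S p c_eq])
    also have "\<dots> = - dd (b 1) c p"
      by (rule dd_minus[OF Ap(2)])
    finally have L: "dd (h 1) (dd (h 2) (W 1)) p = 2 * dd (h 1) (A 1 1) p * c p + dd (b 1) c p" by simp
    have "dd (h 1) (W 1) q = (A 1 2 q + A 2 1 q) * (- c q) - dd (b 1) (X 1) q" if "q \<in> ?S" for q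
      unfolding mixed[OF that] sum_2 diag[OF that] c_eq[OF that] by simp
    then have "dd (h 2) (dd (h 1) (W 1)) p = dd (h 2) (\<lambda>q. (A 1 2 q + A 2 1 q) * (- c q) - dd (b 1) (X 1) q) p"
      by (rule dd_cong_open[OF S p])
    also have "\<dots> = - (dd (h 2) (A 1 2) p + dd (h 2) (A 2 1) p) * c p - dd (h 2) (dd (b 1) (X 1)) p"
      by (simp add: dd_diff dd_mult dd_add dd_minus Ap c_vert[OF p] algebra_simps)
    also have "dd (h 2) (dd (b 1) (X 1)) p = dd (b 1) c p"
      unfolding c_def by (rule comm[OF p smooth(1)])
    finally have R: "dd (h 2) (dd (h 1) (W 1)) p = - (dd (h 2) (A 1 2) p + dd (h 2) (A 2 1) p) * c p - dd (b 1) c p" .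
    have W_comm: "dd (h 1) (dd (h 2) (W 1)) p = dd (h 2) (dd (h 1) (W 1)) p"
      by (rule comm[OF p smooth(2)])
    have "2 * dd (h 1) (A 1 1) p * c p + dd (b 1) c p
        = - (dd (h 2) (A 1 2) p + dd (h 2) (A 2 1) p) * c p - dd (b 1) c p"
      using L R unfolding W_comm by simp
    then show ?thesis
      using Gam_sym[of "fst p" 2 2 1] p by (auto simp: A_d kd_def algebra_simps)
  qed
  have c0: "c p = 0" if p: "p \<in> ?S" for p
  proof -
    have fp: "fst p \<in> U" using p by auto
    have d: "c differentiable (at p)" "dd (b 1) c differentiable (at p)"
      "(\<lambda>q. Gam k i j (fst q)) differentiable (at p)" "(\<lambda>q. snd q $ 1) differentiable (at p)" for k i j
      by (intro diff[OF _ p] c Cinf_on_dd Cinf_on_compose_fst Gam Cinf_on_snd_nth)+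
    have g: "dd (h 1) (\<lambda>q. Gam k i j (fst q)) p = 0" for k i j
      using dd_eq_sum_pdx[OF diff[OF Gam fp]] by (simp add: dd_compose_fst h_def)
    \<comment> \<open>As \<open>c\<close> is constant on fibres, differentiating once more in the
      first fibre direction leaves only \<open>- 3 * Lam * c p\<close>.\<close>
    have "dd (h 1) (\<lambda>q. dd (b 1) c q + c q * (Gam 1 1 1 (fst q) + Gam 2 1 2 (fst q) - 3 * Lam * snd q $ 1)) p
        = dd (h 1) (\<lambda>q. 0) p"
      by (rule dd_cong_open[OF S p integrability])
    then have "0 = dd (h 1) (\<lambda>q. dd (b 1) c q + c q * (Gam 1 1 1 (fst q) + Gam 2 1 2 (fst q) - 3 * Lam * snd q $ 1)) p"
      by simp
    also have "\<dots> = dd (h 1) (dd (b 1) c) p - 3 * Lam * c p"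
      by (simp add: dd_diff dd_mult dd_add d g c_vert[OF p] dd_snd_nth) (simp add: h_def)
    also have "dd (h 1) (dd (b 1) c) p = dd (b 1) (dd (h 1) c) p"
      by (rule comm[OF p c])
    also have "\<dots> = dd (b 1) (\<lambda>q. 0) p"
      by (rule dd_cong_open[OF S p c_vert])
    finally show ?thesis using Lam by simp
  qed
  have X_vert: "dd (h i) (X j) p = 0" if "p \<in> ?S" for i j p
    using diag[OF that] c0[OF that] c_eq[OF that] exhaust_2[of i] exhaust_2[of j] by (auto simp: c_def)
  have X_eq: "X i p = K (fst p) $ i" if "p \<in> ?S" for i p
    using constant_on_fibre[OF smooth(1), of "fst p" i "snd p"] X_vert that
    by (auto simp: X_def K_def h_def)
  have V0: "Cinf_on U (\<lambda>x. V (x, 0))"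
    by (rule Cinf_on_zero_section[OF V]) simp
  have K: "Cinf_on U K"
    unfolding K_def by (rule Cinf_on_bounded_linear[OF U bounded_linear_fst V0])
  have rho: "Cinf_on U rho"
    unfolding rho_def
    by (rule Cinf_on_bounded_linear[OF U bounded_linear_scaleR_right
          Cinf_on_bounded_linear[OF U bounded_linear_snd V0]])
  have X_base: "dd (b j) (X i) p = pdx j (\<lambda>z. K z $ i) (fst p)" if "p \<in> ?S" for i j p
  proof -
    have "dd (b j) (X i) p = dd (b j) (\<lambda>q. K (fst q) $ i) p"
      by (rule dd_cong_open[OF S that X_eq])
    then show ?thesis
      by (simp add: dd_compose_fst[where f = "\<lambda>z. K z $ i"] b_def pdx_def)
  qed
  \<comment> \<open>Since \<open>X\<close> no longer varies along fibres, the \<open>A\<close> terms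
    of \<open>mixed\<close> drop out.\<close>
  have W_vert: "dd (h i) (W j) p = - pdx j (\<lambda>z. K z $ i) (fst p)" if "p \<in> ?S" for i j p
    using mixed[OF that, of i j] X_vert[OF that] X_base[OF that] by simp
  have W_eq: "W j p = - (\<Sum>i\<in>UNIV. snd p $ i * pdx j (\<lambda>z. K z $ i) (fst p)) + W j (fst p, 0)" if p: "p \<in> ?S" for j p
  proof -
    \<comment> \<open>Removing the expected linear part from \<open>W j\<close> leaves a function
      with zero fibre derivative, hence equal to its value on the zero section.\<close>
    let ?f = "\<lambda>q. W j q + (\<Sum>i\<in>UNIV. snd q $ i * pdx j (\<lambda>z. K z $ i) (fst q))"
    have pd: "Cinf_on U (pdx j (\<lambda>z. K z $ i))" for i
      by (intro Cinf_on_intros U K)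
    have f: "Cinf_on ?S ?f"
      by (intro Cinf_on_intros S smooth Cinf_on_snd_nth Cinf_on_compose_fst[OF pd])
    have "dd (h i) ?f q = 0" if q: "q \<in> ?S" for i q
    proof -
      have fq: "fst q \<in> U" using q by auto
      have d: "W j differentiable (at q)" "(\<lambda>q. snd q $ i) differentiable (at q)"
        "(\<lambda>q. pdx j (\<lambda>z. K z $ i) (fst q)) differentiable (at q)" for i
        by (intro diff[OF _ q] smooth Cinf_on_snd_nth Cinf_on_compose_fst[OF pd])+
      have snd_h: "snd (h i) $ k = (if k = i then 1 else 0)" for k
        by (simp add: h_def axis_def)
      have g: "dd (h i) (\<lambda>q. pdx j (\<lambda>z. K z $ k) (fst q)) q = 0" for k
        using dd_eq_sum_pdx[OF diff[OF pd fq]] by (simp add: dd_compose_fst h_def)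
      show ?thesis
        using exhaust_2[of i]
        by (auto simp: dd_add dd_mult sum_2 d g dd_snd_nth W_vert[OF q] snd_h)
    qed
    then have "?f (fst p, snd p) = ?f (fst p, 0)"
      using p by (intro constant_on_fibre[OF f]) (auto simp: h_def)
    then show ?thesis by (simp add: algebra_simps)
  qed
  show V_eq: "V p = lift K rho Lam p" if "p \<in> ?S" for p
  proof -
    have "fst (V p) = K (fst p)"
      using X_eq[OF that] by (simp add: X_def vec_eq_iff)
    moreover have "snd (V p) $ i = snd (lift K rho Lam p) $ i" for i
      using W_eq[OF that, of i] Lam by (simp add: W_def lift_def rho_def)
    ultimately show ?thesis
      by (simp add: prod_eq_iff vec_eq_iff lift_def)
  qed
  have "lieGam K Gam k i j x = kd i k * rho x $ j + kd j k * rho x $ i" if x: "x \<in> U" for x i j k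
  proof -
    let ?E = "\<lambda>k. lieGam K Gam k i j x - kd i k * rho x $ j - kd j k * rho x $ i"
    let ?c = "(schouten_defect K rho i j x + schouten_defect K rho j i x) / (2 * Lam)"
    have eq0: "?c - (\<Sum>k\<in>UNIV. xi $ k * ?E k) = 0" for xi :: "real^2"
    proof -
      have q: "(x, xi) \<in> ?S" using x by simp
      have "lie2 (gmet Gam P Lam) V (x, xi) (axis i 1, 0) (axis j 1, 0)
          = lie2 (gmet Gam P Lam) (lift K rho Lam) (x, xi) (axis i 1, 0) (axis j 1, 0)"
        by (rule lie2_cong_open[OF S q V_eq])
      then have "0 = lie2 (gmet Gam P Lam) (lift K rho Lam) (x, xi) (axis i 1, 0) (axis j 1, 0)"
        by (simp add: lie0[OF q])
      also have "\<dots> = ?c - (\<Sum>k\<in>UNIV. xi $ k * ?E k)"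
        using lie2_gmet_lift[OF K rho, of "(x, xi)" "(axis i 1, 0)" "(axis j 1, 0)"] x
          exhaust_2[of i] exhaust_2[of j]
        by (auto simp: sum_2 axis_def)
      finally show ?thesis by simp
    qed
    \<comment> \<open>An affine function of \<open>xi\<close> vanishes identically:
      \<open>xi = 0\<close> removes the constant, and the unit vector \<open>axis k 1\<close> then
      isolates the coefficient \<open>?E k\<close>.\<close>
    have "?E k = 0"
      using eq0[of 0] eq0[of "axis k 1"] exhaust_2[of k] by (auto simp: sum_2 axis_def)
    then show ?thesis by simp
  qed
  then show "projective_with U Gam K rho"
    using K by (simp add: projective_with_def)
qed

text \<open>The symmetric part of the defect governs the metric and its skew part the 2-form;
  projectivity kills the whole defect and also the \<open>xi\<close>-linear term.\<close>

lemma lift_killing: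
  assumes "projective_with U Gam K rho"
  shows "killing (U \<times> UNIV) (gmet Gam P Lam) (lift K rho Lam)"
    and "p \<in> U \<times> UNIV \<Longrightarrow> lie2 (omega P Lam) (lift K rho Lam) p v w = 0"
proof -
  have K: "Cinf_on U K" and eq: "\<And>x i j k. x \<in> U \<Longrightarrow> lieGam K Gam k i j x = kd i k * rho x $ j + kd j k * rho x $ i"
    using assms by (auto simp: projective_with_def)
  note rho = Cinf_on_projective_form[OF assms]
  show "killing (U \<times> UNIV) (gmet Gam P Lam) (lift K rho Lam)"
    by (auto simp: killing_def Cinf_on_lift[OF K rho] lie2_gmet_lift[OF K rho] schouten_defect_projective[OF assms] eq)
  show "lie2 (omega P Lam) (lift K rho Lam) p v w = 0" if "p \<in> U \<times> UNIV"
  proof -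
    have "fst p \<in> U" using that by auto
    then show ?thesis
      by (simp add: lie2_omega_lift[OF K rho] schouten_defect_projective[OF assms])
  qed
qed

end

theorem theorem6p3:
  fixes U :: "(real^2) set"
    and Gam :: "2 \<Rightarrow> 2 \<Rightarrow> 2 \<Rightarrow> real^2 \<Rightarrow> real"
    and P :: "2 \<Rightarrow> 2 \<Rightarrow> real^2 \<Rightarrow> real"
    and Lam :: real
  assumes "open U"
    and "\<forall>k i j. Cinf_on U (Gam k i j)"
    and "\<forall>x\<in>U. \<forall>k i j. Gam k i j x = Gam k j i x"
    and "is_schouten U Gam P"
    and "Lam \<noteq> 0"
  shows "(\<forall>K rho. projective_with U Gam K rho \<longrightarrow>
            killing (U \<times> UNIV) (gmet Gam P Lam) (lift K rho Lam) \<and>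
            (\<forall>p\<in>U \<times> UNIV. \<forall>v w. lie2 (omega P Lam) (lift K rho Lam) p v w = 0))
       \<and> (\<forall>V. killing (U \<times> UNIV) (gmet Gam P Lam) V \<longrightarrow>
            (\<exists>K rho. projective_with U Gam K rho \<and> (\<forall>p\<in>U \<times> UNIV. V p = lift K rho Lam p)))"
proof -
  have Gam: "\<And>k i j. Cinf_on U (Gam k i j)" and sym: "\<And>x k i j. x \<in> U \<Longrightarrow> Gam k i j x = Gam k j i x"
    using assms(2,3) by auto
  note facts = assms(1) Gam sym assms(4,5)
  have "\<exists>K rho. projective_with U Gam K rho \<and> (\<forall>p\<in>U \<times> UNIV. V p = lift K rho Lam p)"
    if "killing (U \<times> UNIV) (gmet Gam P Lam) V" for V
    \<comment> \<open>The witnesses stay schematic until \<open>killing_imp_lift\<close> supplies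
      the components of \<open>V\<close> on the zero section.\<close>
    by (rule exI)+ (use killing_imp_lift[OF facts that] in blast)
  then show ?thesis
    by (simp add: lift_killing[OF facts])
qed

end
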